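(* Let $N$ be a Poisson point process on a Polish space $\mathbb{X}$ with finite intensity measure $\Lambda$, and let $\mathcal{S}$ be a countable class of measurable functions from $\mathbb{X}$ to $[-1,1]$. For $s\in\mathcal{S}$ put $I(s)=\int_{\mathbb{X}} s(x)\,(\mathrm{d}N(x)-\mathrm{d}\Lambda(x))$, and let $Z=\sup_{s\in\mathcal{S}} I(s)$. Let $L_Z(t)=\log\mathbb{E}[\exp(tZ)]$ for $t \in \mathbb{R}$, $V=\sup_{s\in\mathcal{S}}\operatorname{Var}(I(s))$ and $\upsilon=2\,\mathbb{E}Z+V$. Then: a) for any $t\ge 0$, $$L_Z(-t)\le -t\,\mathbb{E}Z+\frac{\upsilon}{9}\,(e^{3t}-3t-1);$$ b) for any $x\ge 0$, with $h(x)=(1+x)\log(1+x)-x$, $$\mathbb{P}(Z\le \mathbb{E}Z-x)\le \exp\left(-\frac{\upsilon}{9}\,h\left(\frac{3x}{\upsilon}\right)\right);$$ c) for any $x\ge 0$, $$\mathbb{P}(Z\le \mathbb{E}Z-x)\le \exp\left(-\frac{x^2}{\upsilon+\sqrt{\upsilon^2+2\upsilon x}+x}\right)\le \exp\left(-\frac{x^2}{2\upsilon+2x}\right).$$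
   Context: $(\Omega,\mathcal{A},\mathbb{P})$ is the underlying probability space of $N$. A Poisson point process with intensity measure $\Lambda$ is viewed as a random $\mathbb{N}_0$-valued measure $N$, and $\int s\,\mathrm{d}N$ is the sum of the values of $s$ over the points of $N$. *)

theory Defs
  imports "HOL-Probability.Probability"
begin

text \<open>
  A Poisson point process with finite intensity measure \<open>\<Lambda>\<close> on the probability space \<open>M\<close>.
  Each \<open>N \<omega>\<close> is a measure with values in the natural numbers, so that \<open>measure (N \<omega>) A\<close> is the
  number of points in \<open>A\<close>. The Poisson distribution is written out through its point masses
  because \<open>poisson_pmf\<close> is only specified for positive rates, whereas null sets of \<open>\<Lambda>\<close> have
  rate \<open>0\<close> (and then, as \<open>0 ^ 0 = 1\<close>, the formula gives the Dirac measure at \<open>0\<close>).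
  The definition is meaningful for finite \<open>\<Lambda>\<close> only, as \<open>measure \<Lambda> A\<close> is \<open>0\<close> if \<open>\<Lambda> A\<close> is infinite.
\<close>
definition poisson_point_process :: "'w measure \<Rightarrow> 'a measure \<Rightarrow> ('w \<Rightarrow> 'a measure) \<Rightarrow> bool" where
  "poisson_point_process M \<Lambda> N \<longleftrightarrow>
     (\<forall>\<omega>\<in>space M. sets (N \<omega>) = sets \<Lambda> \<and> (\<forall>A\<in>sets \<Lambda>. emeasure (N \<omega>) A \<in> range of_nat)) \<and>
     (\<forall>A\<in>sets \<Lambda>. (\<lambda>\<omega>. measure (N \<omega>) A) \<in> borel_measurable M) \<and>
     (\<forall>A\<in>sets \<Lambda>. \<forall>k::nat.
        measure M {\<omega>\<in>space M. measure (N \<omega>) A = real k} =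
          measure \<Lambda> A ^ k / fact k * exp (- measure \<Lambda> A)) \<and>
     (\<forall>(n::nat) A. (\<forall>i<n. A i \<in> sets \<Lambda>) \<longrightarrow> disjoint_family_on A {..<n} \<longrightarrow>
        prob_space.indep_vars M (\<lambda>_. borel) (\<lambda>i \<omega>. measure (N \<omega>) (A i)) {..<n})"

end

theory Submission
  imports Defs "HOL-Real_Asymp.Real_Asymp"
begin

text \<open>
  The proof is an entropy argument for the lower tail, carried out for finitely many independent Poisson
  counts \<open>x j\<close> with rates \<open>r j\<close> and for the maximum \<open>Z\<close> of finitely many centred sums
  \<open>Y i x\<close> of terms \<open>a i j * (x j - r j)\<close>, where \<open>a i j\<close> is bounded by \<open>1\<close>.

  Let \<open>F t\<close> be the expectation of \<open>exp (- t * Z)\<close> and let \<open>D j\<close> be the increment of \<open>Z\<close> when a point is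
  added to the cell \<open>j\<close>. The modified logarithmic Sobolev inequality \<open>poisson_field_entropy\<close> bounds the
  entropy of \<open>exp (- t * Z)\<close> by the sum of the expectations of \<open>r j * exp (- t * Z) * psi (- (t * D j))\<close>.
  If \<open>\<tau>\<close> is a maximizer, then \<open>a \<tau> j \<le> D j \<le> 1\<close>. Two quantities are under control: the sum of
  \<open>r j * (a \<tau> j)\<^sup>2\<close> is a variance, hence at most \<open>V\<close>; and, by the Mecke equation, the sum over \<open>j\<close> of the
  expectations of \<open>r j * exp (- t * Z) * (D j * exp (- t * D j) - a \<tau> j)\<close> is at most the expectation of
  \<open>Z * exp (- t * Z)\<close> (\<open>self_bounding\<close>), because removing a point lowers \<open>Z\<close> by at most \<open>a \<tau> j\<close> and
  the sum of \<open>a \<tau> j * (x j - r j)\<close> is \<open>Z\<close> itself. The elementary inequality \<open>increment_bound\<close> dominates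
  \<open>psi (- (t * D))\<close> by a combination of exactly these two quantities, with coefficients that depend on
  \<open>t\<close> only. The outcome is a linear differential inequality for \<open>ln (F t)\<close>, of which
  \<open>- t * E Z + (2 * E Z + V) / 9 * (exp (3 * t) - 3 * t - 1)\<close> is a supersolution with the same value
  and slope at \<open>0\<close>; \<open>log_laplace_bound\<close> is the resulting comparison.

  The logarithmic Sobolev inequality itself is trivial for one Bernoulli variable, where it only says
  that a convex function lies above its tangents. Convexity of the divergence \<open>bregman\<close> propagates it
  to binomial laws, the Poisson limit theorem to Poisson laws, and Jensen's inequality to independent
  families.

  For a point process, finitely many functions are rounded to step functions on a common finite
  partition, whose cell counts are independent Poisson variables. A single limit in the accuracy and in
  the number of functions yields the countable class. Parts b) and c) are Chernoff's
  bound followed by calculus.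
\<close>

section \<open>An inequality for increments\<close>

text \<open>
  Relative to \<open>exp (- t * Z)\<close>, the entropy cost of a jump of \<open>Z\<close> by \<open>D\<close> is \<open>psi (- (t * D))\<close>. It enters through the
  derivative \<open>x * exp x\<close>, which makes the quadratic scaling below a one-line comparison.
\<close>

definition psi :: "real \<Rightarrow> real" where
  "psi x = x * exp x - exp x + 1"

lemma has_real_derivative_psi: "(psi has_real_derivative x * exp x) (at x)"
  unfolding psi_def by (auto intro!: derivative_eq_intros)

text \<open>
  Since \<open>psi x / x\<^sup>2\<close> is the average of \<open>v * exp (x * v)\<close> over \<open>v\<close> in \<open>[0, 1]\<close>, it increases
  with \<open>x\<close>. In the proof both sides are compared through their derivatives in \<open>x\<close>.
\<close>

lemma psi_scale:
  assumes c: "\<bar>c\<bar> \<le> 1" and x: "x \<ge> 0"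
  shows "psi (c * x) \<le> c\<^sup>2 * psi x"
proof -
  let ?G = "\<lambda>x. c\<^sup>2 * psi x - psi (c * x)"
  have "?G 0 \<le> ?G x"
  proof (rule DERIV_nonneg_imp_nondecreasing[OF x])
    fix y :: real assume y: "0 \<le> y" "y \<le> x"
    have "(?G has_real_derivative c\<^sup>2 * (y * exp y) - (c * y * exp (c * y)) * c) (at y)"
      by (auto intro!: derivative_eq_intros DERIV_chain2[OF has_real_derivative_psi]
          has_real_derivative_psi)
    moreover have "c * y \<le> y" using mult_right_mono[of c 1 y] c y by auto
    then have "c\<^sup>2 * y * exp (c * y) \<le> c\<^sup>2 * y * exp y" using y by (intro mult_left_mono) auto
    then have "c\<^sup>2 * (y * exp y) - (c * y * exp (c * y)) * c \<ge> 0"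
      by (simp add: power2_eq_square mult_ac)
    ultimately show "\<exists>d. (?G has_real_derivative d) (at y) \<and> 0 \<le> d" by blast
  qed
  then show ?thesis by (simp add: psi_def)
qed

lemma psi_nonneg: "psi x \<ge> 0"
proof -
  have "1 + (-x) \<le> exp (-x)" by (rule exp_ge_add_one_self)
  then have "(1 - x) * exp x \<le> exp (-x) * exp x" by (intro mult_right_mono) auto
  then show ?thesis by (simp add: psi_def exp_minus algebra_simps)
qed

lemma psi_pos: "x > 0 \<Longrightarrow> psi x > 0"
proof -
  assume x: "x > 0"
  have "1 + (-x) < exp (-x)" using exp_minus_greater[of x] x by simp
  then have "(1 - x) * exp x < exp (-x) * exp x" by (intro mult_strict_right_mono) auto
  then show ?thesis by (simp add: psi_def exp_minus algebra_simps)
qed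

lemma exp_remainder_le_psi:
  assumes "t \<ge> 0" shows "exp t - 1 - t \<le> psi t"
proof -
  let ?G = "\<lambda>t. psi t - (exp t - 1 - t)"
  have "?G 0 \<le> ?G t"
  proof (rule DERIV_nonneg_imp_nondecreasing[OF assms])
    fix y :: real
    have "(?G has_real_derivative psi y) (at y)"
      by (auto intro!: derivative_eq_intros has_real_derivative_psi simp: psi_def)
    then show "\<exists>d. (?G has_real_derivative d) (at y) \<and> 0 \<le> d" using psi_nonneg by blast
  qed
  then show ?thesis by (simp add: psi_def)
qed

lemma exp_interpolate:
  fixes x y u :: real
  assumes "0 \<le> u" "u \<le> 1"
  shows "exp ((1 - u) * x + u * y) \<le> (1 - u) * exp x + u * exp y"
  using convex_onD[OF exp_convex, of u x y] assms by simp

text \<open>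
  The case \<open>a = D\<close> of the next lemma. The coefficient \<open>p * (1 + 2 * r)\<close> splits as \<open>p + 2 * p * r\<close>.
  The part \<open>p\<close> absorbs the entropy cost by \<open>psi_scale\<close> with factor \<open>- D / 3\<close>; this is where
  the exponent \<open>3 * t\<close> of the final bound comes from. The part \<open>2 * p * r\<close> absorbs the rest, because
  \<open>(1 - exp (- (t * D))) / D\<close> is at most \<open>r\<close>.
\<close>

lemma increment_bound_diagonal:
  fixes t D :: real
  defines "p \<equiv> psi (3 * t) / 9" and "r \<equiv> (exp (3 * t) - 1) / 3"
  assumes t: "t \<ge> 0" and D: "\<bar>D\<bar> \<le> 1"
  shows "psi (- (t * D)) \<le> 2 * p * (D * exp (- (t * D)) - D) + p * (1 + 2 * r) * D\<^sup>2"
proof -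
  have p: "p \<ge> 0" using psi_nonneg by (simp add: p_def)
  have "psi ((- D / 3) * (3 * t)) \<le> (- D / 3)\<^sup>2 * psi (3 * t)"
    using D t by (intro psi_scale) auto
  then have *: "psi (- (t * D)) \<le> p * D\<^sup>2"
    by (simp add: p_def power_divide mult_ac)
  have r1: "t \<le> r" using exp_ge_add_one_self[of "3 * t"] by (simp add: r_def algebra_simps)
  have y: "exp t \<ge> 1" using t by simp
  have e3: "exp (3 * t) = exp t ^ 3" by (simp add: exp_of_nat_mult[symmetric])
  have "0 \<le> (exp t - 1) * ((exp t)\<^sup>2 + exp t - 2)"
    using y one_le_power[OF y, of 2] by (intro mult_nonneg_nonneg) linarith+
  then have r2: "exp t - 1 \<le> r"
    unfolding r_def e3 by (simp add: algebra_simps power2_eq_square power3_eq_cube)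
  have "D * (1 - exp (- (t * D))) \<le> r * D\<^sup>2"
  proof (cases "D \<ge> 0")
    case True
    have "1 - exp (- (t * D)) \<le> t * D" using exp_ge_add_one_self[of "- (t * D)"] by linarith
    also have "\<dots> \<le> r * D" using r1 True by (intro mult_right_mono) auto
    finally have "D * (1 - exp (- (t * D))) \<le> D * (r * D)" using True by (intro mult_left_mono)
    then show ?thesis by (simp add: power2_eq_square mult_ac)
  next
    case False
    define d where "d = - D"
    have d: "0 \<le> d" "d \<le> 1" using False D by (auto simp: d_def)
    have "exp (t * d) - 1 \<le> d * (exp t - 1)"
      using exp_interpolate[OF d, of 0 t] by (simp add: algebra_simps)
    also have "\<dots> \<le> d * r" using r2 d by (intro mult_left_mono) auto
    finally have "d * (exp (t * d) - 1) \<le> d * (d * r)" using d by (intro mult_left_mono)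
    then show ?thesis by (simp add: d_def power2_eq_square algebra_simps)
  qed
  then have "p * (D * (1 - exp (- (t * D)))) \<le> p * (r * D\<^sup>2)"
    using p by (intro mult_left_mono)
  with * show ?thesis by (simp add: algebra_simps)
qed

text \<open>
  The pointwise heart of the proof: the entropy cost of an increment \<open>D\<close> of the supremum is paid by
  the difference \<open>D * exp (- (t * D)) - a\<close>, whose sum is controlled by self-bounding, and by \<open>a\<^sup>2\<close>,
  whose sum is a variance; here \<open>a\<close> is the increment of the functional that attained the supremum
  before the jump, so \<open>a \<le> D\<close>.

  As a function of \<open>a\<close> the right-hand side is a parabola with minimum at \<open>\<sigma> = 1 / (1 + 2 * r)\<close>. If
  \<open>D \<le> \<sigma>\<close>, the worst case is \<open>a = D\<close>, which is the diagonal case. If \<open>D > \<sigma>\<close>, the worst case is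
  \<open>a = \<sigma>\<close>; multiplied by \<open>exp (t * D)\<close> the difference of the two sides then becomes a concave
  function \<open>G\<close> of \<open>D\<close>, so that it suffices to look at the end points \<open>\<sigma>\<close> (again diagonal) and \<open>1\<close>.
\<close>

lemma increment_bound:
  fixes t a D :: real
  defines "p \<equiv> psi (3 * t) / 9" and "r \<equiv> (exp (3 * t) - 1) / 3"
  assumes t: "t \<ge> 0" and a: "- 1 \<le> a" "a \<le> D" and D: "D \<le> 1"
  shows "psi (- (t * D)) \<le> 2 * p * (D * exp (- (t * D)) - a) + p * (1 + 2 * r) * a\<^sup>2"
proof -
  define \<sigma> where "\<sigma> = 1 / (1 + 2 * r)"
  have p: "p \<ge> 0" using psi_nonneg by (simp add: p_def)
  have r: "r \<ge> 0" using t by (simp add: r_def)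
  have \<sigma>: "0 < \<sigma>" "\<sigma> \<le> 1" "(1 + 2 * r) = 1 / \<sigma>" using r by (auto simp: \<sigma>_def)
  have square: "p * (1 + 2 * r) * x\<^sup>2 - 2 * p * x = p / \<sigma> * (x - \<sigma>)\<^sup>2 - p * \<sigma>" for x
    using \<sigma>(1) unfolding \<sigma>(3) by (simp add: field_simps power2_eq_square)
  show ?thesis
  proof (cases "D \<le> \<sigma>")
    case True
    have "(D - \<sigma>)\<^sup>2 \<le> (a - \<sigma>)\<^sup>2"
      using True a by (subst abs_le_square_iff[symmetric]) auto
    then have "p / \<sigma> * (D - \<sigma>)\<^sup>2 \<le> p / \<sigma> * (a - \<sigma>)\<^sup>2"
      using p \<sigma> by (intro mult_left_mono) auto
    moreover have "psi (- (t * D)) \<le> 2 * p * (D * exp (- (t * D)) - D) + p * (1 + 2 * r) * D\<^sup>2"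
      unfolding p_def r_def using t a D by (intro increment_bound_diagonal) auto
    ultimately show ?thesis using square[of D] square[of a] by (simp add: algebra_simps)
  next
    case False
    define G where "G = (\<lambda>x. 1 + (2 * p + t) * x - (1 + p * \<sigma>) * exp (t * x))"
    have G_iff: "exp (- (t * x)) * G x = 2 * p * x * exp (- (t * x)) - p * \<sigma> - psi (- (t * x))" for x
    proof -
      have "exp (- (t * x)) * exp (t * x) = 1" by (simp flip: exp_add)
      then show ?thesis unfolding G_def psi_def by (simp add: algebra_simps)
    qed
    have G\<sigma>: "G \<sigma> \<ge> 0"
    proof -
      have "psi (- (t * \<sigma>)) \<le> 2 * p * (\<sigma> * exp (- (t * \<sigma>)) - \<sigma>) + p * (1 + 2 * r) * \<sigma>\<^sup>2"
        unfolding p_def r_def using t \<sigma> by (intro increment_bound_diagonal) auto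
      then have "exp (- (t * \<sigma>)) * G \<sigma> \<ge> 0"
        unfolding G_iff using square[of \<sigma>] by (simp add: algebra_simps)
      then show ?thesis by (simp add: zero_le_mult_iff)
    qed
    have G1: "G 1 \<ge> 0"
    proof -
      define y where "y = exp t"
      have y: "y \<ge> 1" using t by (simp add: y_def)
      have e3: "exp (3 * t) = y ^ 3" by (simp add: y_def exp_of_nat_mult[symmetric])
      \<comment> \<open>\<open>(y - 1) * (2 * y\<^sup>2 + 2 * y - 1) = 2 * y ^ 3 - 3 * y + 1\<close>, hence \<open>\<sigma> * y \<le> 1\<close>\<close>
      have "0 \<le> (y - 1) * (2 * y\<^sup>2 + 2 * y - 1)"
        using y one_le_power[OF y, of 2] by (intro mult_nonneg_nonneg) linarith+
      then have "3 * y \<le> 1 + 2 * y ^ 3"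
        by (simp add: algebra_simps power2_eq_square power3_eq_cube)
      then have sy: "\<sigma> * y \<le> 1" using y unfolding \<sigma>_def r_def e3
        by (simp add: field_simps)
      have "psi ((1/3) * (3 * t)) \<le> (1/3)\<^sup>2 * psi (3 * t)" using t by (intro psi_scale) auto
      then have "exp t - 1 - t \<le> p"
        using exp_remainder_le_psi[OF t] by (simp add: p_def power_divide)
      moreover have "p * (\<sigma> * y) \<le> p * 1" using sy p by (intro mult_left_mono)
      ultimately show ?thesis unfolding G_def by (simp add: y_def algebra_simps)
    qed
    \<comment> \<open>concavity of \<open>G\<close>: \<open>D\<close> is the convex combination of \<open>\<sigma>\<close> and \<open>1\<close> with weight \<open>u\<close>\<close>
    define u where "u = (D - \<sigma>) / (1 - \<sigma>)"
    have u: "0 \<le> u" "u \<le> 1" using False D by (auto simp: u_def field_simps)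
    have "u * (1 - \<sigma>) = D - \<sigma>" using False D by (simp add: u_def)
    then have Du: "D = (1 - u) * \<sigma> + u * 1" by (simp add: algebra_simps)
    have "exp (t * D) \<le> (1 - u) * exp (t * \<sigma>) + u * exp t"
      using exp_interpolate[OF u, of "t * \<sigma>" t] by (simp add: Du algebra_simps)
    then have "(1 + p * \<sigma>) * exp (t * D) \<le> (1 + p * \<sigma>) * ((1 - u) * exp (t * \<sigma>) + u * exp t)"
      using p \<sigma> by (intro mult_left_mono) auto
    then have "(1 - u) * G \<sigma> + u * G 1 \<le> G D"
      unfolding G_def by (simp add: Du algebra_simps)
    moreover have "0 \<le> (1 - u) * G \<sigma> + u * G 1" using u G\<sigma> G1 by simp
    ultimately have "0 \<le> exp (- (t * D)) * G D" by simp
    then have "psi (- (t * D)) \<le> 2 * p * D * exp (- (t * D)) - p * \<sigma>" unfolding G_iff by simp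
    moreover have "- (p * \<sigma>) \<le> p * (1 + 2 * r) * a\<^sup>2 - 2 * p * a"
      unfolding square using p \<sigma> by simp
    ultimately show ?thesis by (simp add: algebra_simps)
  qed
qed

section \<open>From the differential inequality to tail bounds\<close>

text \<open>
  Where \<open>u\<close> is positive, the inequality forces \<open>t * u' t < u t\<close>, so that \<open>u t / t\<close> strictly
  decreases. But \<open>u t / t\<close>, extended by the value \<open>u' 0 = 0\<close> at the origin, is continuous and
  hence attains its maximum on \<open>[0, t]\<close>; a positive maximum would be exceeded just to the left.
\<close>

lemma nonpos_of_differential_inequality:
  fixes u u' \<alpha> :: "real \<Rightarrow> real"
  assumes u: "\<And>t. (u has_real_derivative u' t) (at t)"
    and u0: "u 0 = 0" "u' 0 = 0"
    and le: "\<And>t. t > 0 \<Longrightarrow> (t + \<alpha> t) * u' t \<le> u t"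
    and \<alpha>: "\<And>t. t > 0 \<Longrightarrow> \<alpha> t > 0"
    and t: "t \<ge> 0"
  shows "u t \<le> 0"
proof (rule ccontr)
  assume neg: "\<not> u t \<le> 0"
  then have t: "t > 0" using t u0 by (cases "t = 0") auto
  define g where "g = (\<lambda>t. if t = 0 then 0 else u t / t)"
  have cont: "continuous_on {0..t} g"
  proof -
    have "isCont g x" for x
    proof (cases "x = 0")
      case True
      have "((\<lambda>h. (u (0 + h) - u 0) / h) \<longlongrightarrow> 0) (at 0)"
        using u[of 0] u0 by (simp add: DERIV_def)
      then have "(g \<longlongrightarrow> 0) (at 0)"
        by (rule Lim_transform_eventually) (auto simp: g_def u0 eventually_at_filter)
      then show ?thesis by (simp add: isCont_def True g_def)
    next
      case False
      have "(g \<longlongrightarrow> u x / x) (at x)"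
      proof (rule Lim_transform_eventually)
        show "((\<lambda>t. u t / t) \<longlongrightarrow> u x / x) (at x)"
          using DERIV_isCont[OF u[of x]] False by (auto intro!: tendsto_intros simp: isCont_def)
        have "eventually (\<lambda>y. y \<noteq> 0) (nhds x)" using False by (intro t1_space_nhds) auto
        then show "\<forall>\<^sub>F y in at x. u y / y = g y"
          by (auto simp: g_def eventually_at_filter elim!: eventually_mono)
      qed
      then show ?thesis using False by (simp add: isCont_def g_def)
    qed
    then show ?thesis by (intro continuous_at_imp_continuous_on) auto
  qed
  obtain m where m: "m \<in> {0..t}" "\<And>y. y \<in> {0..t} \<Longrightarrow> g y \<le> g m"
    using continuous_attains_sup[OF _ _ cont] t by force
  have "g t > 0" using t neg by (auto simp: g_def)
  then have gm: "g m > 0" using m(2)[of t] t by auto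
  then have m0: "m > 0" "u m > 0" using m(1) by (auto simp: g_def zero_less_divide_iff split: if_splits)
  let ?d = "(u' m * m - u m * 1) / (m * m)"
  have "((\<lambda>t. u t / t) has_real_derivative ?d) (at m)"
    using m0 by (intro DERIV_divide u DERIV_ident) auto
  moreover have "?d < 0"
  proof -
    have "m * u' m < u m"
    proof (cases "u' m \<le> 0")
      case True
      then have "m * u' m \<le> 0" using m0 by (simp add: mult_nonneg_nonpos)
      then show ?thesis using m0 by linarith
    next
      case False
      then have "\<alpha> m * u' m > 0" using \<alpha>[OF m0(1)] by simp
      then show ?thesis using le[OF m0(1)] by (simp add: algebra_simps)
    qed
    then show ?thesis using m0 by (simp add: divide_less_0_iff mult_ac)
  qed
  ultimately obtain d where d: "d > 0" "\<And>h. 0 < h \<Longrightarrow> h < d \<Longrightarrow> u m / m < u (m - h) / (m - h)"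
    using DERIV_neg_dec_left by blast
  define h where "h = min (d / 2) (m / 2)"
  have h: "0 < h" "h < d" "h < m" using d m0 by (auto simp: h_def)
  have "g (m - h) > g m" using d(2)[OF h(1,2)] h m0 by (simp add: g_def)
  then show False using m(2)[of "m - h"] m(1) h by auto
qed

lemma ln_ge_three_minus:
  fixes r :: real
  assumes "r \<ge> 1" shows "3 - 3 / r \<le> ln ((3 * r\<^sup>2 - 1) / 2)"
proof -
  let ?G = "\<lambda>r::real. ln ((3 * r\<^sup>2 - 1) / 2) - (3 - 3 / r)"
  have "?G 1 \<le> ?G r"
  proof (rule DERIV_nonneg_imp_nondecreasing[OF assms])
    fix y :: real assume y: "1 \<le> y" "y \<le> r"
    have y2: "y\<^sup>2 \<ge> 1" using y by simp
    have "(?G has_real_derivative 6 * y / (3 * y\<^sup>2 - 1) - 3 / y\<^sup>2) (at y)"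
      using y y2 by (auto intro!: derivative_eq_intros simp: power2_eq_square)
    moreover have "3 / y\<^sup>2 \<le> 6 * y / (3 * y\<^sup>2 - 1)"
    proof -
      have "0 \<le> (y - 1)\<^sup>2 * (2 * y + 1)" using y by simp
      also have "\<dots> = 2 * y ^ 3 - 3 * y\<^sup>2 + 1"
        by (simp add: algebra_simps power2_eq_square power3_eq_cube)
      finally show ?thesis using y2 y
        by (simp add: field_simps power2_eq_square power3_eq_cube)
    qed
    ultimately show "\<exists>d. (?G has_real_derivative d) (at y) \<and> 0 \<le> d"
      by (intro exI[of _ "6 * y / (3 * y\<^sup>2 - 1) - 3 / y\<^sup>2"]) auto
  qed
  then show ?thesis by simp
qed

text \<open>
  The substitution \<open>r = sqrt (1 + 2 * y)\<close> turns the left-hand side into \<open>9 * (r - 1)\<^sup>2 / 2\<close>; the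
  derivatives of the two sides in \<open>r\<close> are then compared by \<open>ln_ge_three_minus\<close>.
\<close>

lemma bennett_ge_bernstein_sqrt:
  fixes y :: real
  assumes "y \<ge> 0"
  shows "9 * (1 + y - sqrt (1 + 2 * y)) \<le> (1 + 3 * y) * ln (1 + 3 * y) - 3 * y"
proof -
  let ?w = "\<lambda>r::real. (3 * r\<^sup>2 - 1) / 2"
  define E where "E = (\<lambda>w::real. w * ln w - w)"
  let ?G = "\<lambda>r::real. E (?w r) + 1 - 9 * (r - 1)\<^sup>2 / 2"
  define r where "r = sqrt (1 + 2 * y)"
  have r: "1 \<le> r" using assms by (simp add: r_def)
  have "?G 1 \<le> ?G r"
  proof (rule DERIV_nonneg_imp_nondecreasing[OF r])
    fix x :: real assume x: "1 \<le> x" "x \<le> r"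
    have x2: "x\<^sup>2 \<ge> 1" using x by simp
    have w: "(?w has_real_derivative 3 * x) (at x)"
      by (auto intro!: derivative_eq_intros)
    have "?w x > 0" using x2 by simp
    then have "(E has_real_derivative ln (?w x)) (at (?w x))"
      unfolding E_def by (auto intro!: derivative_eq_intros)
    from DERIV_chain2[OF this w]
    have "(?G has_real_derivative 3 * x * ln (?w x) - 9 * (x - 1)) (at x)"
      by (auto intro!: derivative_eq_intros simp: field_simps)
    moreover have "x * (3 - 3 / x) \<le> x * ln (?w x)"
      using x by (intro mult_left_mono ln_ge_three_minus) auto
    then have "3 * x * ln (?w x) - 9 * (x - 1) \<ge> 0" using x by (simp add: algebra_simps)
    ultimately show "\<exists>d. (?G has_real_derivative d) (at x) \<and> 0 \<le> d" by blast
  qed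
  moreover have "?G 1 = 0" by (simp add: E_def)
  ultimately have G: "0 \<le> E (?w r) + 1 - 9 * (r - 1)\<^sup>2 / 2" by linarith
  have r2: "r\<^sup>2 = 1 + 2 * y" using assms by (simp add: r_def)
  then have w: "?w r = 1 + 3 * y" by simp
  have "9 * (r - 1)\<^sup>2 / 2 = 9 * (1 + y - r)"
    using r2 by (simp add: power2_eq_square field_simps)
  with G show ?thesis unfolding w by (simp add: r_def E_def)
qed

text \<open>
  The first bound is the optimal choice \<open>t = ln (1 + 3 * x / \<upsilon>) / 3\<close>. The degenerate case \<open>\<upsilon> = 0\<close>
  is treated separately, because there \<open>3 * x / \<upsilon> = 0\<close> by convention: the first bound reads
  \<open>P \<le> 1\<close>, and the second one, which reads \<open>P \<le> exp (- x)\<close>, is the choice \<open>t = 1\<close>.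
\<close>

lemma chernoff_bounds:
  fixes P \<upsilon> x :: real
  assumes v: "\<upsilon> \<ge> 0" and x: "x \<ge> 0"
    and P: "\<And>t. t \<ge> 0 \<Longrightarrow> P \<le> exp (\<upsilon> / 9 * (exp (3 * t) - 3 * t - 1) - t * x)"
    and h: "h = (\<lambda>x. (1 + x) * ln (1 + x) - x)"
  shows "P \<le> exp (- (\<upsilon> / 9) * h (3 * x / \<upsilon>))"
    and "P \<le> exp (- (x\<^sup>2 / (\<upsilon> + sqrt (\<upsilon>\<^sup>2 + 2 * \<upsilon> * x) + x)))"
    and "exp (- (x\<^sup>2 / (\<upsilon> + sqrt (\<upsilon>\<^sup>2 + 2 * \<upsilon> * x) + x))) \<le> exp (- (x\<^sup>2 / (2 * \<upsilon> + 2 * x)))"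
proof -
  show 1: "P \<le> exp (- (\<upsilon> / 9) * h (3 * x / \<upsilon>))"
  proof (cases "\<upsilon> = 0")
    case True
    then show ?thesis using P[of 0] by (simp add: h)
  next
    case False
    then have v: "\<upsilon> > 0" using v by simp
    define w where "w = 1 + 3 * x / \<upsilon>"
    have w: "w \<ge> 1" using x v by (simp add: w_def)
    have xw: "x = \<upsilon> * (w - 1) / 3" using v by (simp add: w_def)
    have "P \<le> exp (\<upsilon> / 9 * (exp (3 * (ln w / 3)) - 3 * (ln w / 3) - 1) - ln w / 3 * x)"
      using w by (intro P) auto
    also have "\<upsilon> / 9 * (exp (3 * (ln w / 3)) - 3 * (ln w / 3) - 1) - ln w / 3 * x
        = - (\<upsilon> / 9) * (w * ln w - (w - 1))"
      using w by (simp add: xw field_simps)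
    also have "w * ln w - (w - 1) = h (3 * x / \<upsilon>)" by (simp add: h w_def)
    finally show ?thesis .
  qed
  show "P \<le> exp (- (x\<^sup>2 / (\<upsilon> + sqrt (\<upsilon>\<^sup>2 + 2 * \<upsilon> * x) + x)))"
  proof (cases "\<upsilon> = 0")
    case True
    then show ?thesis using P[of 1] by (cases "x = 0") (auto simp: power2_eq_square)
  next
    case False
    then have v: "\<upsilon> > 0" using v by simp
    define y where "y = x / \<upsilon>"
    have y: "y \<ge> 0" and xy: "x = \<upsilon> * y" using x v by (auto simp: y_def)
    have "sqrt (\<upsilon>\<^sup>2 + 2 * \<upsilon> * x) = sqrt (\<upsilon>\<^sup>2 * (1 + 2 * y))"
      by (simp add: xy power2_eq_square algebra_simps)
    also have "\<dots> = \<upsilon> * sqrt (1 + 2 * y)" using v by (simp add: real_sqrt_mult)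
    finally have s: "sqrt (\<upsilon>\<^sup>2 + 2 * \<upsilon> * x) = \<upsilon> * sqrt (1 + 2 * y)" .
    have "y\<^sup>2 = (1 + y - sqrt (1 + 2 * y)) * (1 + y + sqrt (1 + 2 * y))"
    proof -
      have "sqrt (1 + 2 * y) * sqrt (1 + 2 * y) = 1 + 2 * y" using y by simp
      then show ?thesis by (simp add: algebra_simps power2_eq_square)
    qed
    moreover have "1 + y + sqrt (1 + 2 * y) > 0" using y by (simp add: add_pos_nonneg)
    ultimately have "y\<^sup>2 / (1 + y + sqrt (1 + 2 * y)) = 1 + y - sqrt (1 + 2 * y)"
      by (simp add: field_simps)
    moreover have "\<upsilon> + sqrt (\<upsilon>\<^sup>2 + 2 * \<upsilon> * x) + x = \<upsilon> * (1 + y + sqrt (1 + 2 * y))"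
      unfolding s by (simp add: xy algebra_simps)
    moreover have "x\<^sup>2 = \<upsilon> * (\<upsilon> * y\<^sup>2)" by (simp add: xy power2_eq_square)
    ultimately have "x\<^sup>2 / (\<upsilon> + sqrt (\<upsilon>\<^sup>2 + 2 * \<upsilon> * x) + x) = \<upsilon> * (1 + y - sqrt (1 + 2 * y))"
      using v by (metis mult_divide_mult_cancel_left less_irrefl times_divide_eq_right)
    also have "\<dots> \<le> \<upsilon> * (((1 + 3 * y) * ln (1 + 3 * y) - 3 * y) / 9)"
      using bennett_ge_bernstein_sqrt[OF y] v by (intro mult_left_mono) auto
    also have "\<dots> = \<upsilon> / 9 * h (3 * x / \<upsilon>)" using v by (simp add: h xy)
    finally show ?thesis using 1 by (smt (verit) exp_le_cancel_iff mult_minus_left)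
  qed
  show "exp (- (x\<^sup>2 / (\<upsilon> + sqrt (\<upsilon>\<^sup>2 + 2 * \<upsilon> * x) + x))) \<le> exp (- (x\<^sup>2 / (2 * \<upsilon> + 2 * x)))"
  proof (cases "x = 0")
    case False
    have "sqrt (\<upsilon>\<^sup>2 + 2 * \<upsilon> * x) \<le> \<upsilon> + x"
      using v x by (intro real_le_lsqrt) (auto simp: power2_eq_square algebra_simps)
    moreover have "0 \<le> sqrt (\<upsilon>\<^sup>2 + 2 * \<upsilon> * x)" using v x by simp
    ultimately have "x\<^sup>2 / (2 * \<upsilon> + 2 * x) \<le> x\<^sup>2 / (\<upsilon> + sqrt (\<upsilon>\<^sup>2 + 2 * \<upsilon> * x) + x)"
      using False v x by (intro divide_left_mono mult_pos_pos) (linarith | simp)+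
    then show ?thesis by simp
  qed simp
qed

section \<open>Entropy of Bernoulli, binomial and Poisson laws\<close>

text \<open>
  The Bregman divergence of the function \<open>x * ln x\<close>, with base point \<open>x\<close>.
\<close>

definition bregman :: "real \<Rightarrow> real \<Rightarrow> real" where
  "bregman x y = y * ln (y / x) - y + x"

text \<open>
  \<open>bregman\<close> is jointly convex and homogeneous of degree one. Hence it lies above its tangent plane
  at \<open>(a, c)\<close>, which is linear without constant term; both convexity and Jensen's inequality
  are obtained by averaging this plane.
\<close>

lemma bregman_tangent:
  assumes "x > 0" "y > 0" "a > 0" "c > 0"
  shows "y * ln (c / a) + x * (1 - c / a) \<le> bregman x y"
proof -
  have "ln ((x * c) / (y * a)) \<le> (x * c) / (y * a) - 1" using assms by (intro ln_le_minus_one) auto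
  moreover have "ln ((x * c) / (y * a)) = ln (c / a) - ln (y / x)"
    using assms by (simp add: ln_div ln_mult)
  ultimately have "y * (ln (c / a) - ln (y / x)) \<le> y * ((x * c) / (y * a) - 1)"
    using assms by (intro mult_left_mono) auto
  also have "\<dots> = x * c / a - y" using assms by (simp add: field_simps)
  finally show ?thesis unfolding bregman_def by (simp add: algebra_simps)
qed

lemma bregman_eq_tangent:
  assumes "a > 0" shows "bregman a c = c * ln (c / a) + a * (1 - c / a)"
  using assms by (simp add: bregman_def algebra_simps)

lemma bregman_nonneg: "x > 0 \<Longrightarrow> y > 0 \<Longrightarrow> bregman x y \<ge> 0"
  using bregman_tangent[of x y 1 1] by simp

lemma bregman_convex:
  assumes "x > 0" "y > 0" "x' > 0" "y' > 0" "0 \<le> p" "p \<le> 1"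
  shows "bregman ((1 - p) * x + p * x') ((1 - p) * y + p * y')
    \<le> (1 - p) * bregman x y + p * bregman x' y'"
proof -
  define a where "a = (1 - p) * x + p * x'"
  define c where "c = (1 - p) * y + p * y'"
  have ac: "a > 0" "c > 0"
    unfolding a_def c_def using assms by (cases "p = 0"; simp add: add_nonneg_pos)+
  have lin: "c * L + a * K = (1 - p) * (y * L + x * K) + p * (y' * L + x' * K)" for L K
    by (simp add: a_def c_def algebra_simps)
  have "bregman a c = (1 - p) * (y * ln (c / a) + x * (1 - c / a))
      + p * (y' * ln (c / a) + x' * (1 - c / a))"
    unfolding bregman_eq_tangent[OF ac(1)] by (rule lin)
  also have "\<dots> \<le> (1 - p) * bregman x y + p * bregman x' y'"
    using assms ac by (intro add_mono mult_left_mono bregman_tangent) auto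
  finally show ?thesis by (simp add: a_def c_def)
qed

text \<open>
  Bound \<open>m * ln m\<close> from below by the tangent of \<open>x * ln x\<close> at \<open>x\<close>.
\<close>

lemma bernoulli_entropy:
  fixes x y p :: real
  defines "m \<equiv> (1 - p) * x + p * y"
  assumes "x > 0" "y > 0" "0 \<le> p" "p \<le> 1"
  shows "(1 - p) * (x * ln x) + p * (y * ln y) - m * ln m \<le> p * bregman x y"
proof -
  have m: "m > 0" unfolding m_def using assms by (cases "p = 0"; simp add: add_nonneg_pos)
  have "0 \<le> bregman x m" using m assms by (intro bregman_nonneg)
  then have "m * ln x + m - x \<le> m * ln m" using m assms by (simp add: bregman_def ln_div algebra_simps)
  moreover have "m * ln x + m - x = (1 - p) * (x * ln x) + p * (y * ln x) + p * (y - x)"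
    by (simp add: m_def algebra_simps)
  moreover have "p * bregman x y = p * (y * ln y) - p * (y * ln x) - p * (y - x)"
    using assms by (simp add: bregman_def ln_div algebra_simps)
  ultimately show ?thesis by linarith
qed

text \<open>
  The averaging operator of adding one Bernoulli variable: its \<open>m\<close>-th power at \<open>0\<close> is the
  expectation under the binomial law with parameters \<open>m\<close> and \<open>p\<close>.
\<close>

definition bernoulli_step :: "real \<Rightarrow> (nat \<Rightarrow> real) \<Rightarrow> nat \<Rightarrow> real" where
  "bernoulli_step p f k = (1 - p) * f k + p * f (Suc k)"

lemma bernoulli_steps_pos:
  assumes "0 \<le> p" "p < 1" "\<And>k. f k > 0"
  shows "(bernoulli_step p ^^ m) f k > 0"
  using assms by (induction m arbitrary: k) (auto simp: bernoulli_step_def less_imp_le intro!: add_pos_nonneg mult_nonneg_nonneg)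

lemma bernoulli_steps_nonneg:
  assumes "0 \<le> p" "p < 1" "\<And>k. f k \<ge> 0"
  shows "(bernoulli_step p ^^ m) f k \<ge> 0"
  using assms by (induction m arbitrary: k) (auto simp: bernoulli_step_def)

lemma bregman_bernoulli_steps:
  assumes p: "0 \<le> p" "p < 1" and f: "\<And>k. f k > 0"
  shows "bregman ((bernoulli_step p ^^ m) f k) ((bernoulli_step p ^^ m) f (Suc k))
    \<le> (bernoulli_step p ^^ m) (\<lambda>k. bregman (f k) (f (Suc k))) k"
proof (induction m arbitrary: k)
  case (Suc m)
  let ?g = "(bernoulli_step p ^^ m) f"
  let ?B = "(bernoulli_step p ^^ m) (\<lambda>k. bregman (f k) (f (Suc k)))"
  have "bregman (bernoulli_step p ?g k) (bernoulli_step p ?g (Suc k))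
      \<le> (1 - p) * bregman (?g k) (?g (Suc k)) + p * bregman (?g (Suc k)) (?g (Suc (Suc k)))"
    unfolding bernoulli_step_def[of p ?g] using p f by (intro bregman_convex bernoulli_steps_pos) auto
  also have "\<dots> \<le> (1 - p) * ?B k + p * ?B (Suc k)"
    using p by (intro add_mono mult_left_mono Suc.IH) auto
  finally show ?case by (simp add: bernoulli_step_def[of p ?g] bernoulli_step_def[of p ?B])
qed simp

text \<open>
  The entropy produced by the last Bernoulli variable is bounded by \<open>bernoulli_entropy\<close>, and the
  divergence that arises there is moved inside the other averages by convexity. The factor
  \<open>1 / (1 - p)\<close> pays for replacing \<open>m\<close> averages by \<open>m + 1\<close>, so that both sides use the same
  number of steps; it disappears in the Poisson limit.
\<close>

lemma binomial_entropy:
  assumes p: "0 \<le> p" "p < 1" and f: "\<And>k. f k > 0"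
  shows "(bernoulli_step p ^^ m) (\<lambda>k. f k * ln (f k)) k
      - (bernoulli_step p ^^ m) f k * ln ((bernoulli_step p ^^ m) f k)
    \<le> real m * (p / (1 - p)) * (bernoulli_step p ^^ m) (\<lambda>k. bregman (f k) (f (Suc k))) k"
proof (induction m arbitrary: k)
  case (Suc m)
  let ?T = "bernoulli_step p"
  let ?F = "(?T ^^ m) (\<lambda>k. f k * ln (f k))"
  let ?g = "(?T ^^ m) f"
  let ?B = "(?T ^^ m) (\<lambda>k. bregman (f k) (f (Suc k)))"
  let ?c = "real m * (p / (1 - p))"
  have B: "?B k \<ge> 0" for k using p f by (intro bernoulli_steps_nonneg bregman_nonneg) auto
  have "?T ?F k - ?T ?g k * ln (?T ?g k)
      = ((1 - p) * (?F k - ?g k * ln (?g k)) + p * (?F (Suc k) - ?g (Suc k) * ln (?g (Suc k))))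
      + ((1 - p) * (?g k * ln (?g k)) + p * (?g (Suc k) * ln (?g (Suc k))) - ?T ?g k * ln (?T ?g k))"
    by (simp add: bernoulli_step_def[of p ?F] algebra_simps)
  also have "\<dots> \<le> ((1 - p) * (?c * ?B k) + p * (?c * ?B (Suc k))) + p * bregman (?g k) (?g (Suc k))"
  proof (intro add_mono mult_left_mono Suc.IH)
    show "(1 - p) * (?g k * ln (?g k)) + p * (?g (Suc k) * ln (?g (Suc k))) - ?T ?g k * ln (?T ?g k)
        \<le> p * bregman (?g k) (?g (Suc k))"
      unfolding bernoulli_step_def[of p ?g] using p f by (intro bernoulli_entropy bernoulli_steps_pos) auto
  qed (use p in auto)
  also have "p * bregman (?g k) (?g (Suc k)) \<le> p * ?B k"
    using p f by (intro mult_left_mono bregman_bernoulli_steps) auto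
  also have "p * ?B k \<le> p / (1 - p) * ?T ?B k"
  proof -
    have "(1 - p) * ?B k \<le> ?T ?B k" using p B by (simp add: bernoulli_step_def[of p ?B])
    then have "p / (1 - p) * ((1 - p) * ?B k) \<le> p / (1 - p) * ?T ?B k"
      using p by (intro mult_left_mono) auto
    then show ?thesis using p by simp
  qed
  also have "(1 - p) * (?c * ?B k) + p * (?c * ?B (Suc k)) + p / (1 - p) * ?T ?B k
      = real (Suc m) * (p / (1 - p)) * ?T ?B k"
    unfolding bernoulli_step_def[of p ?B k] distrib_left of_nat_Suc distrib_right by simp
  finally show ?case by simp
qed simp

lemma bernoulli_steps_eq_sum:
  "(bernoulli_step p ^^ m) f k = (\<Sum>i\<le>m. real (m choose i) * p ^ i * (1 - p) ^ (m - i) * f (k + i))"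
proof (induction m arbitrary: k)
  case (Suc m)
  have "(\<Sum>i\<le>Suc m. real (Suc m choose i) * p ^ i * (1 - p) ^ (Suc m - i) * f (k + i))
    = (1 - p) ^ Suc m * f k + (\<Sum>i\<le>m. (real (m choose i) + real (m choose Suc i)) * p ^ Suc i * (1 - p) ^ (m - i) * f (k + Suc i))"
    by (subst sum.atMost_Suc_shift) simp
  also have "\<dots> = p * (\<Sum>i\<le>m. real (m choose i) * p ^ i * (1 - p) ^ (m - i) * f (Suc k + i))
    + ((1 - p) ^ Suc m * f k + (\<Sum>i\<le>m. real (m choose Suc i) * p ^ Suc i * (1 - p) ^ (m - i) * f (k + Suc i)))"
    by (simp add: sum_distrib_left sum.distrib algebra_simps)
  also have "(1 - p) ^ Suc m * f k + (\<Sum>i\<le>m. real (m choose Suc i) * p ^ Suc i * (1 - p) ^ (m - i) * f (k + Suc i))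
    = (\<Sum>i\<le>Suc m. real (m choose i) * p ^ i * (1 - p) ^ (Suc m - i) * f (k + i))"
    by (subst sum.atMost_Suc_shift) simp
  also have "\<dots> = (\<Sum>i\<le>m. real (m choose i) * p ^ i * (1 - p) ^ (Suc m - i) * f (k + i))"
    by simp
  also have "\<dots> = (1 - p) * (\<Sum>i\<le>m. real (m choose i) * p ^ i * (1 - p) ^ (m - i) * f (k + i))"
    by (subst sum_distrib_left) (auto intro!: sum.cong simp: Suc_diff_le)
  finally show ?case by (simp add: bernoulli_step_def[of p "(bernoulli_step p ^^ m) f"] Suc.IH)
qed simp

lemma choose_over_power_tendsto:
  "(\<lambda>m. real (m choose k) / real m ^ k) \<longlonglongrightarrow> 1 / fact k"
proof (induction k)
  case (Suc k)
  have "(\<lambda>m. real (m choose k) / real m ^ k * ((real m - real k) / real m) / (real k + 1)) \<longlonglongrightarrow> 1 / fact k * 1 / (real k + 1)"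
    by (intro tendsto_intros Suc.IH) (real_asymp, simp)
  moreover have "\<forall>\<^sub>F m in sequentially. real (m choose k) / real m ^ k * ((real m - real k) / real m) / (real k + 1)
      = real (m choose Suc k) / real m ^ Suc k"
    using eventually_gt_at_top[of k]
  proof eventually_elim
    case (elim m)
    have "Suc k * (m choose Suc k) = (m - k) * (m choose k)"
      using binomial_absorb_comp[of m k] binomial_absorption[of k m] elim
      by (metis Suc_times_binomial_add add_diff_inverse_nat less_imp_le_nat not_less)
    then have "(real k + 1) * real (m choose Suc k) = (real m - real k) * real (m choose k)"
      using elim by (metis of_nat_mult of_nat_Suc of_nat_diff less_imp_le_nat add.commute)
    then have "real (m choose Suc k) = (real m - real k) * real (m choose k) / (real k + 1)"
      by (simp add: field_simps)
    then show ?case by (simp add: mult_ac)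
  qed
  ultimately have "(\<lambda>m. real (m choose Suc k) / real m ^ Suc k) \<longlonglongrightarrow> 1 / fact k * 1 / (real k + 1)"
    by (rule Lim_transform_eventually)
  then show ?case by (simp add: field_simps)
qed simp

text \<open>
  The Poisson limit theorem for unbounded functions, by dominated convergence of series: the binomial
  weights are dominated by \<open>r ^ k / fact k\<close>.
\<close>

lemma bernoulli_steps_tendsto_poisson:
  assumes r: "r \<ge> 0" and f: "summable (\<lambda>k. r ^ k / fact k * \<bar>f k\<bar>)"
  shows "(\<lambda>m. (bernoulli_step (r / real m) ^^ m) f 0) \<longlonglongrightarrow> (\<Sum>k. r ^ k / fact k * exp (- r) * f k)"
proof -
  define a where "a = (\<lambda>k m. real (m choose k) * (r / real m) ^ k * (1 - r / real m) ^ (m - k) * f k)"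
  have sum_eq: "(bernoulli_step (r / real m) ^^ m) f 0 = (\<Sum>k. a k m)" for m
    unfolding bernoulli_steps_eq_sum by (subst suminf_finite[of "{..m}"]) (auto simp: a_def)
  have lim: "(\<lambda>m. a k m) \<longlonglongrightarrow> r ^ k / fact k * exp (- r) * f k" for k
  proof -
    have *: "(\<lambda>m. 1 - r / real m) \<longlonglongrightarrow> 1" by real_asymp
    have "(\<lambda>m. (1 + (- r) / real m) ^ m) \<longlonglongrightarrow> exp (- r)" by (rule tendsto_exp_limit_sequentially)
    then have "(\<lambda>m. r ^ k * (real (m choose k) / real m ^ k) * ((1 - r / real m) ^ m / (1 - r / real m) ^ k) * f k)
      \<longlonglongrightarrow> r ^ k * (1 / fact k) * (exp (- r) / 1 ^ k) * f k"
      by (intro tendsto_intros choose_over_power_tendsto *) auto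
    moreover have "\<forall>\<^sub>F m in sequentially. r ^ k * (real (m choose k) / real m ^ k) * ((1 - r / real m) ^ m / (1 - r / real m) ^ k) * f k = a k m"
      using eventually_ge_at_top[of k] order_tendstoD(1)[OF *, of 0, simplified]
    proof eventually_elim
      case (elim m)
      then have "(1 - r / real m) ^ (m - k) = (1 - r / real m) ^ m / (1 - r / real m) ^ k"
        by (intro power_diff) auto
      then show ?case by (simp add: a_def power_divide mult_ac)
    qed
    ultimately have "(\<lambda>m. a k m) \<longlonglongrightarrow> r ^ k * (1 / fact k) * (exp (- r) / 1 ^ k) * f k"
      by (rule Lim_transform_eventually)
    then show ?thesis by simp
  qed
  have bound: "norm (a k m) \<le> r ^ k / fact k * \<bar>f k\<bar>" if m: "m > 0" "real m \<ge> r" for k m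
  proof -
    have "real (m choose k) * fact k \<le> real m ^ k"
      using binomial_fact_pow[of m k] by (metis of_nat_fact of_nat_le_iff of_nat_mult of_nat_power)
    then have "real (m choose k) \<le> real m ^ k / fact k" by (simp add: field_simps)
    then have "real (m choose k) * (r / real m) ^ k \<le> real m ^ k / fact k * (r / real m) ^ k"
      using r by (intro mult_right_mono) auto
    also have "\<dots> = r ^ k / fact k" using m by (simp add: power_divide)
    finally have "real (m choose k) * (r / real m) ^ k \<le> r ^ k / fact k" .
    moreover have "(1 - r / real m) ^ (m - k) \<le> 1"
      using r m by (intro power_le_one) auto
    moreover have "1 - r / real m \<ge> 0" using m by simp
    ultimately have "real (m choose k) * (r / real m) ^ k * (1 - r / real m) ^ (m - k) \<le> r ^ k / fact k * 1"
      using r by (intro mult_mono) auto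
    then have "real (m choose k) * (r / real m) ^ k * (1 - r / real m) ^ (m - k) * \<bar>f k\<bar>
        \<le> r ^ k / fact k * 1 * \<bar>f k\<bar>"
      by (rule mult_right_mono) simp
    then show ?thesis using r m by (simp add: a_def abs_mult)
  qed
  have "(\<lambda>m. \<Sum>k. a k m) \<longlonglongrightarrow> (\<Sum>k. r ^ k / fact k * exp (- r) * f k)"
  proof -
    have "\<forall>\<^sub>F m in sequentially. m > 0 \<and> real m \<ge> r"
      using eventually_gt_at_top[of 0] filterlim_real_sequentially
      by (auto simp: filterlim_at_top eventually_conj_iff)
    then have "\<forall>\<^sub>F (k, m) in at_top \<times>\<^sub>F sequentially. norm (a k m) \<le> r ^ k / fact k * \<bar>f k\<bar>"
      unfolding eventually_prod_filter
      by - (rule exI[of _ "\<lambda>_. True"], rule exI[of _ "\<lambda>m. m > 0 \<and> real m \<ge> r"], use bound in auto)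
    from tannerys_theorem[OF lim this f] show ?thesis by simp
  qed
  then show ?thesis by (simp add: sum_eq)
qed

text \<open>
  A class of functions of point counts that is closed under all operations needed below and whose
  members are integrable for Poisson laws; \<open>w x\<close> is the number of points of the configuration \<open>x\<close>.
  The exponent \<open>Suc (w x)\<close> instead of a separate constant keeps everything in one parameter \<open>b\<close>.
\<close>

definition exp_growth :: "('x \<Rightarrow> nat) \<Rightarrow> ('x \<Rightarrow> real) \<Rightarrow> bool" where
  "exp_growth w g \<longleftrightarrow> (\<exists>b\<ge>1. \<forall>x. \<bar>g x\<bar> \<le> b ^ Suc (w x))"

lemma exp_growthI: "b \<ge> 1 \<Longrightarrow> (\<And>x. \<bar>g x\<bar> \<le> b ^ Suc (w x)) \<Longrightarrow> exp_growth w g"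
  unfolding exp_growth_def by blast

lemma exp_growth_bound:
  assumes "exp_growth w h" "\<And>x. \<bar>g x\<bar> \<le> \<bar>h x\<bar>" shows "exp_growth w g"
  using assms unfolding exp_growth_def by (meson order_trans)

lemma exp_growth_const: "exp_growth w (\<lambda>_. c)"
proof (rule exp_growthI)
  fix x
  have "\<bar>c\<bar> \<le> max 1 \<bar>c\<bar> ^ 1" by simp
  also have "\<dots> \<le> max 1 \<bar>c\<bar> ^ Suc (w x)" by (intro power_increasing) auto
  finally show "\<bar>c\<bar> \<le> max 1 \<bar>c\<bar> ^ Suc (w x)" .
qed simp

lemma exp_growth_weight: "exp_growth w (\<lambda>x. real (w x))"
proof (rule exp_growthI[of 2])
  fix x
  have "w x \<le> 2 ^ w x" by (rule less_imp_le[OF less_exp])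
  then have "real (w x) \<le> 2 ^ w x" by (metis of_nat_le_iff of_nat_numeral of_nat_power)
  also have "\<dots> \<le> 2 ^ Suc (w x)" by (intro power_increasing) auto
  finally show "\<bar>real (w x)\<bar> \<le> 2 ^ Suc (w x)" by simp
qed simp

lemma power_add_le:
  fixes a b :: real assumes "a \<ge> 0" "b \<ge> 0" shows "a ^ Suc n + b ^ Suc n \<le> (a + b) ^ Suc n"
proof (induction n)
  case (Suc n)
  have "a ^ Suc (Suc n) + b ^ Suc (Suc n) \<le> (a + b) * a ^ Suc n + (a + b) * b ^ Suc n"
    using assms by (simp add: algebra_simps)
  also have "\<dots> = (a + b) * (a ^ Suc n + b ^ Suc n)" by (simp add: algebra_simps)
  also have "\<dots> \<le> (a + b) * (a + b) ^ Suc n" using assms by (intro mult_left_mono Suc.IH) auto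
  finally show ?case by simp
qed simp

lemma exp_growth_add:
  assumes "exp_growth w f" "exp_growth w g" shows "exp_growth w (\<lambda>x. f x + g x)"
proof -
  obtain a b where a: "a \<ge> 1" "\<And>x. \<bar>f x\<bar> \<le> a ^ Suc (w x)" and b: "b \<ge> 1" "\<And>x. \<bar>g x\<bar> \<le> b ^ Suc (w x)"
    using assms unfolding exp_growth_def by blast
  show ?thesis
  proof (rule exp_growthI[of "a + b"])
    fix x
    have "\<bar>f x + g x\<bar> \<le> a ^ Suc (w x) + b ^ Suc (w x)" using a(2)[of x] b(2)[of x] by linarith
    also have "\<dots> \<le> (a + b) ^ Suc (w x)" using a(1) b(1) by (intro power_add_le) auto
    finally show "\<bar>f x + g x\<bar> \<le> (a + b) ^ Suc (w x)" .
  qed (use a b in auto)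
qed

lemma exp_growth_mult:
  assumes "exp_growth w f" "exp_growth w g" shows "exp_growth w (\<lambda>x. f x * g x)"
proof -
  obtain a b where a: "a \<ge> 1" "\<And>x. \<bar>f x\<bar> \<le> a ^ Suc (w x)" and b: "b \<ge> 1" "\<And>x. \<bar>g x\<bar> \<le> b ^ Suc (w x)"
    using assms unfolding exp_growth_def by blast
  show ?thesis
  proof (rule exp_growthI[of "a * b"])
    show "1 \<le> a * b" using a(1) b(1) mult_mono[of 1 a 1 b] by simp
    show "\<bar>f x * g x\<bar> \<le> (a * b) ^ Suc (w x)" for x
      unfolding abs_mult power_mult_distrib using a b by (intro mult_mono) auto
  qed
qed

lemma exp_growth_minus: "exp_growth w g \<Longrightarrow> exp_growth w (\<lambda>x. - g x)"
  by (erule exp_growth_bound) simp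

lemma exp_growth_diff:
  "exp_growth w f \<Longrightarrow> exp_growth w g \<Longrightarrow> exp_growth w (\<lambda>x. f x - g x)"
  using exp_growth_add[of w f "\<lambda>x. - g x"] exp_growth_minus[of w g] by simp

lemma exp_growth_sum:
  assumes "\<And>i. i \<in> J \<Longrightarrow> exp_growth w (f i)" shows "exp_growth w (\<lambda>x. \<Sum>i\<in>J. f i x)"
  using assms by (induction J rule: infinite_finite_induct) (auto intro: exp_growth_const exp_growth_add)

lemma exp_growth_compose:
  assumes "exp_growth w g" "\<And>x. w (h x) \<le> w' x + c" shows "exp_growth w' (\<lambda>x. g (h x))"
proof -
  obtain b where b: "b \<ge> 1" "\<And>x. \<bar>g x\<bar> \<le> b ^ Suc (w x)" using assms unfolding exp_growth_def by blast
  show ?thesis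
  proof (rule exp_growthI[of "b ^ Suc c"])
    fix x
    have "\<bar>g (h x)\<bar> \<le> b ^ Suc (w (h x))" by (rule b)
    also have "\<dots> \<le> b ^ (Suc c * Suc (w' x))"
      using b(1) assms(2)[of x] by (intro power_increasing) auto
    finally show "\<bar>g (h x)\<bar> \<le> (b ^ Suc c) ^ Suc (w' x)" by (simp only: power_mult)
  qed (use b one_le_power in blast)
qed

lemma exp_growth_exp:
  assumes "\<And>x. \<bar>g x\<bar> \<le> c * (1 + real (w x))" "c \<ge> 0" shows "exp_growth w (\<lambda>x. exp (t * g x))"
proof (rule exp_growthI[of "exp (\<bar>t\<bar> * c)"])
  fix x
  have "t * g x \<le> \<bar>t\<bar> * \<bar>g x\<bar>" by (metis abs_ge_self abs_mult)
  also have "\<dots> \<le> \<bar>t\<bar> * (c * (1 + real (w x)))" using assms by (intro mult_left_mono) auto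
  finally have "exp (t * g x) \<le> exp (real (Suc (w x)) * (\<bar>t\<bar> * c))" by (simp add: algebra_simps)
  then show "\<bar>exp (t * g x)\<bar> \<le> exp (\<bar>t\<bar> * c) ^ Suc (w x)"
    by (simp only: exp_of_nat_mult abs_exp_cancel)
qed (use assms in auto)

text \<open>
  Positive functions whose logarithm may be integrated as well.
\<close>

definition log_growth :: "('x \<Rightarrow> nat) \<Rightarrow> ('x \<Rightarrow> real) \<Rightarrow> bool" where
  "log_growth w f \<longleftrightarrow> (\<forall>x. f x > 0) \<and> exp_growth w f \<and> exp_growth w (\<lambda>x. 1 / f x)"

lemma log_growth_ln: assumes "log_growth w f" shows "exp_growth w (\<lambda>x. ln (f x))"
proof (rule exp_growth_bound)
  show "exp_growth w (\<lambda>x. f x + 1 / f x)"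
    using assms by (intro exp_growth_add) (auto simp: log_growth_def)
  show "\<bar>ln (f x)\<bar> \<le> \<bar>f x + 1 / f x\<bar>" for x
  proof -
    have f: "f x > 0" using assms by (auto simp: log_growth_def)
    have "ln (f x) \<le> f x - 1" "ln (1 / f x) \<le> 1 / f x - 1"
      using f by (intro ln_le_minus_one; simp)+
    moreover have "ln (1 / f x) = - ln (f x)" using f by (simp add: ln_div)
    moreover have "1 / f x > 0" using f by simp
    ultimately show ?thesis using f by linarith
  qed
qed

lemma log_growth_compose:
  assumes "log_growth w g" "\<And>x. w (h x) \<le> w' x + c" shows "log_growth w' (\<lambda>x. g (h x))"
  using assms exp_growth_compose[of w g h w' c] exp_growth_compose[of w "\<lambda>x. 1 / g x" h w' c]
  by (auto simp: log_growth_def)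

lemma log_growth_entropy: "log_growth w f \<Longrightarrow> exp_growth w (\<lambda>x. f x * ln (f x))"
  by (intro exp_growth_mult log_growth_ln) (auto simp: log_growth_def)

lemma log_growth_bregman:
  assumes "log_growth w f" "log_growth w g" shows "exp_growth w (\<lambda>x. bregman (f x) (g x))"
proof -
  have "exp_growth w (\<lambda>x. g x * (ln (g x) - ln (f x)) - g x + f x)"
    using assms by (intro exp_growth_add exp_growth_diff exp_growth_mult log_growth_ln) (auto simp: log_growth_def)
  moreover have "g x * (ln (g x) - ln (f x)) - g x + f x = bregman (f x) (g x)" for x
    using assms by (simp add: bregman_def log_growth_def ln_div less_imp_neq[symmetric])
  ultimately show ?thesis by simp
qed

lemma expectation_pos:
  fixes p :: "'x pmf" and f :: "'x \<Rightarrow> real"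
  assumes "integrable p f" "\<And>x. f x > 0"
  shows "measure_pmf.expectation p f > 0"
  using assms by (intro measure_pmf.expectation_greater) auto

text \<open>
  The rate \<open>0\<close> has to be included, since cells of a partition may be null sets.
\<close>

definition poisson_law :: "real \<Rightarrow> nat pmf" where
  "poisson_law r = (if r > 0 then poisson_pmf r else return_pmf 0)"

lemma pmf_poisson_law:
  "r \<ge> 0 \<Longrightarrow> pmf (poisson_law r) k = r ^ k / fact k * exp (- r)"
  by (cases k) (auto simp: poisson_law_def)

context
  fixes r :: real assumes r: "r \<ge> 0"
begin

lemma summable_poisson_weights:
  assumes "exp_growth (\<lambda>k. k) f" shows "summable (\<lambda>k. r ^ k / fact k * \<bar>f k\<bar>)"
proof -
  obtain b where b: "b \<ge> 1" "\<And>k. \<bar>f k\<bar> \<le> b ^ Suc k" using assms unfolding exp_growth_def by blast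
  show ?thesis
  proof (rule summable_comparison_test')
    show "summable (\<lambda>k. b * (inverse (fact k) * (r * b) ^ k))"
      by (intro summable_mult summable_exp)
    show "norm (r ^ k / fact k * \<bar>f k\<bar>) \<le> b * (inverse (fact k) * (r * b) ^ k)" if "k \<ge> 0" for k
    proof -
      have "r ^ k / fact k * \<bar>f k\<bar> \<le> r ^ k / fact k * b ^ Suc k"
        using r by (intro mult_left_mono b) auto
      then show ?thesis using r by (simp add: power_mult_distrib field_simps)
    qed
  qed
qed

lemma integrable_poisson:
  assumes "exp_growth (\<lambda>k. k) f" shows "integrable (poisson_law r) f"
  unfolding measure_pmf_eq_density
  using summable_mult[OF summable_poisson_weights[OF assms], of "exp (- r)"] r
  by (subst integrable_density) (auto simp: integrable_count_space_nat_iff pmf_poisson_law abs_mult mult_ac)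

lemma expectation_poisson:
  assumes "exp_growth (\<lambda>k. k) f"
  shows "measure_pmf.expectation (poisson_law r) f = (\<Sum>k. r ^ k / fact k * exp (- r) * f k)"
proof -
  have "measure_pmf.expectation (poisson_law r) f
      = (\<integral>k. pmf (poisson_law r) k *\<^sub>R f k \<partial>count_space UNIV)"
    unfolding measure_pmf_eq_density by (subst integral_density) auto
  also have "\<dots> = (\<Sum>k. pmf (poisson_law r) k *\<^sub>R f k)"
    using integrable_poisson[OF assms] unfolding measure_pmf_eq_density
    by (intro integral_count_space_nat) (simp add: integrable_density)
  finally show ?thesis by (simp add: pmf_poisson_law[OF r])
qed

text \<open>
  The characteristic (Mecke) equation, an index shift in the exponential series.
\<close>

lemma poisson_mecke:
  assumes f: "exp_growth (\<lambda>k. k) f"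
  shows "measure_pmf.expectation (poisson_law r) (\<lambda>k. real k * f k)
    = r * measure_pmf.expectation (poisson_law r) (\<lambda>k. f (Suc k))"
proof -
  have g: "exp_growth (\<lambda>k. k) (\<lambda>k. real k * f k)"
    using exp_growth_weight[of "\<lambda>k. k"] f by (intro exp_growth_mult) auto
  have h: "exp_growth (\<lambda>k. k) (\<lambda>k. f (Suc k))"
    by (rule exp_growth_compose[OF f, of Suc _ 1]) auto
  have summ: "summable (\<lambda>k. r ^ k / fact k * exp (- r) * u k)" if "exp_growth (\<lambda>k. k) u" for u
    using summable_mult[OF summable_poisson_weights[OF that], of "exp (- r)"] r
    by (intro summable_norm_cancel[of "\<lambda>k. r ^ k / fact k * exp (- r) * u k"]) (simp add: abs_mult mult_ac)
  have "(\<Sum>k. r ^ k / fact k * exp (- r) * (real k * f k))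
      = (\<Sum>k. r ^ Suc k / fact (Suc k) * exp (- r) * (real (Suc k) * f (Suc k)))"
    using suminf_split_head[OF summ[OF g]] by simp
  also have "(\<lambda>k. r ^ Suc k / fact (Suc k) * exp (- r) * (real (Suc k) * f (Suc k)))
      = (\<lambda>k. r * (r ^ k / fact k * exp (- r) * f (Suc k)))"
    by (simp del: of_nat_Suc add: mult_ac)
  also have "(\<Sum>k. r * (r ^ k / fact k * exp (- r) * f (Suc k))) = r * (\<Sum>k. r ^ k / fact k * exp (- r) * f (Suc k))"
    by (rule suminf_mult[OF summ[OF h]])
  finally show ?thesis by (simp only: expectation_poisson[OF g] expectation_poisson[OF h])
qed

text \<open>
  The modified logarithmic Sobolev inequality of the Poisson law, as the limit of
  \<open>binomial_entropy\<close> with \<open>p = r / m\<close>.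
\<close>

lemma poisson_entropy:
  assumes f: "log_growth (\<lambda>k. k) f"
  defines "E \<equiv> measure_pmf.expectation (poisson_law r)"
  shows "E (\<lambda>k. f k * ln (f k)) - E f * ln (E f) \<le> r * E (\<lambda>k. bregman (f k) (f (Suc k)))"
proof -
  have f': "log_growth (\<lambda>k. k) (\<lambda>k. f (Suc k))"
    by (rule log_growth_compose[OF f, of Suc _ 1]) auto
  have pos: "f k > 0" for k using f by (simp add: log_growth_def)
  let ?B = "\<lambda>k. bregman (f k) (f (Suc k))"
  let ?T = "\<lambda>m. bernoulli_step (r / real m) ^^ m"
  have lim: "(\<lambda>m. ?T m g 0) \<longlonglongrightarrow> E g" if "exp_growth (\<lambda>k. k) g" for g
    unfolding E_def expectation_poisson[OF that]
    by (rule bernoulli_steps_tendsto_poisson[OF r summable_poisson_weights[OF that]])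
  have gf: "exp_growth (\<lambda>k. k) f" using f by (simp add: log_growth_def)
  have "E f > 0"
  proof -
    have "integrable (poisson_law r) f" by (rule integrable_poisson[OF gf])
    then show ?thesis unfolding E_def using pos by (rule expectation_pos)
  qed
  then have lim1: "(\<lambda>m. ?T m (\<lambda>k. f k * ln (f k)) 0 - ?T m f 0 * ln (?T m f 0))
      \<longlonglongrightarrow> E (\<lambda>k. f k * ln (f k)) - E f * ln (E f)"
    by (intro tendsto_diff tendsto_mult tendsto_ln lim gf log_growth_entropy f) auto
  have lim2: "(\<lambda>m. real m * (r / real m / (1 - r / real m)) * ?T m ?B 0) \<longlonglongrightarrow> r * E ?B"
  proof (intro tendsto_mult lim log_growth_bregman f f')
    show "(\<lambda>m. real m * (r / real m / (1 - r / real m))) \<longlonglongrightarrow> r" by real_asymp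
  qed
  have "\<forall>\<^sub>F m in sequentially. ?T m (\<lambda>k. f k * ln (f k)) 0 - ?T m f 0 * ln (?T m f 0)
      \<le> real m * (r / real m / (1 - r / real m)) * ?T m ?B 0"
  proof -
    have "\<forall>\<^sub>F m in sequentially. real m > r"
      using filterlim_real_sequentially by (auto simp: filterlim_at_top_dense)
    then show ?thesis
    proof eventually_elim
      case (elim m)
      then show ?case using r pos by (intro binomial_entropy) auto
    qed
  qed
  then show ?thesis by (rule tendsto_le[OF trivial_limit_sequentially lim2 lim1])
qed

end

section \<open>Fields of independent Poisson variables\<close>


lemma bregman_jensen:
  fixes p :: "'x pmf"
  defines "E \<equiv> measure_pmf.expectation p"
  assumes f: "integrable p f" "\<And>x. f x > 0" and g: "integrable p g" "\<And>x. g x > 0"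
    and B: "integrable p (\<lambda>x. bregman (f x) (g x))"
  shows "bregman (E f) (E g) \<le> E (\<lambda>x. bregman (f x) (g x))"
proof -
  have pos: "E f > 0" "E g > 0"
    unfolding E_def using f g by (auto intro: expectation_pos)
  have lin: "E (\<lambda>x. g x * c + f x * d) = E g * c + E f * d" for c d
    using f g by (simp add: E_def)
  have "bregman (E f) (E g) = E (\<lambda>x. g x * ln (E g / E f) + f x * (1 - E g / E f))"
    unfolding bregman_eq_tangent[OF pos(1)] lin ..
  also have "\<dots> \<le> E (\<lambda>x. bregman (f x) (g x))"
    unfolding E_def using f g B pos
    by (intro integral_mono bregman_tangent Bochner_Integration.integrable_add integrable_mult_left)
       (auto simp: E_def)
  finally show ?thesis .
qed

text \<open>
  Fubini's theorem for products of discrete laws, for nonnegative functions by means of the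
  nonnegative integral and then for signed ones by splitting off the absolute value.
\<close>

lemma expectation_pair_pmf_nonneg:
  fixes h :: "'a \<times> 'b \<Rightarrow> real"
  assumes "\<And>z. h z \<ge> 0" "\<And>x. integrable (measure_pmf q) (\<lambda>y. h (x, y))"
  shows "measure_pmf.expectation (pair_pmf p q) h
    = measure_pmf.expectation p (\<lambda>x. measure_pmf.expectation q (\<lambda>y. h (x, y)))"
proof -
  have "(\<integral>\<^sup>+z. ennreal (h z) \<partial>pair_pmf p q)
      = (\<integral>\<^sup>+x. ennreal (measure_pmf.expectation q (\<lambda>y. h (x, y))) \<partial>p)"
    unfolding nn_integral_pair_pmf' using assms
    by (intro nn_integral_cong nn_integral_eq_integral) auto
  then show ?thesis using assms by (simp add: integral_eq_nn_integral)
qed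

lemma expectation_pair_pmf:
  fixes h :: "'a \<times> 'b \<Rightarrow> real"
  assumes h: "integrable (measure_pmf (pair_pmf p q)) h"
    and q: "\<And>x. integrable (measure_pmf q) (\<lambda>y. h (x, y))"
    and p: "integrable (measure_pmf p) (\<lambda>x. measure_pmf.expectation q (\<lambda>y. \<bar>h (x, y)\<bar>))"
           "integrable (measure_pmf p) (\<lambda>x. measure_pmf.expectation q (\<lambda>y. h (x, y)))"
  shows "measure_pmf.expectation (pair_pmf p q) h
    = measure_pmf.expectation p (\<lambda>x. measure_pmf.expectation q (\<lambda>y. h (x, y)))"
proof -
  have 1: "measure_pmf.expectation (pair_pmf p q) (\<lambda>z. \<bar>h z\<bar>)
    = measure_pmf.expectation p (\<lambda>x. measure_pmf.expectation q (\<lambda>y. \<bar>h (x, y)\<bar>))"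
    using q by (intro expectation_pair_pmf_nonneg) auto
  have "measure_pmf.expectation (pair_pmf p q) (\<lambda>z. h z + \<bar>h z\<bar>)
    = measure_pmf.expectation p (\<lambda>x. measure_pmf.expectation q (\<lambda>y. h (x, y) + \<bar>h (x, y)\<bar>))"
    using q by (intro expectation_pair_pmf_nonneg) auto
  then show ?thesis using 1 h q p by simp
qed

definition total_count :: "'j set \<Rightarrow> ('j \<Rightarrow> nat) \<Rightarrow> nat" where
  "total_count A x = (\<Sum>j\<in>A. x j)"

definition add_point :: "'j \<Rightarrow> ('j \<Rightarrow> nat) \<Rightarrow> 'j \<Rightarrow> nat" where
  "add_point j x = x(j := Suc (x j))"

lemma total_count_insert:
  "finite A \<Longrightarrow> i \<notin> A \<Longrightarrow> total_count (insert i A) (x(i := k)) = k + total_count A x"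
  by (auto simp: total_count_def intro!: sum.cong)

lemma total_count_upd_outside:
  "i \<notin> A \<Longrightarrow> total_count A (x(i := k)) = total_count A x"
  by (auto simp: total_count_def intro!: sum.cong)

lemma total_count_add_point:
  assumes "finite A" shows "total_count A (add_point j x) \<le> total_count A x + 1"
proof (cases "j \<in> A")
  case True
  then show ?thesis using assms
    by (auto simp: total_count_def add_point_def sum.remove[of A j] intro!: sum_mono)
next
  case False
  then show ?thesis by (simp add: add_point_def total_count_upd_outside)
qed

lemma exp_growth_add_point:
  "finite A \<Longrightarrow> exp_growth (total_count A) g \<Longrightarrow> exp_growth (total_count A) (\<lambda>x. g (add_point j x))"
  by (erule exp_growth_compose[of _ _ _ _ 1]) (rule total_count_add_point)

lemma log_growth_add_point:
  "finite A \<Longrightarrow> log_growth (total_count A) g \<Longrightarrow> log_growth (total_count A) (\<lambda>x. g (add_point j x))"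
  by (erule log_growth_compose[of _ _ _ _ 1]) (rule total_count_add_point)

lemma exp_growth_component:
  assumes "finite A" "j \<in> A" shows "exp_growth (total_count A) (\<lambda>x. real (x j))"
proof (rule exp_growth_bound[OF exp_growth_weight])
  show "\<bar>real (x j)\<bar> \<le> \<bar>real (total_count A x)\<bar>" for x
    using assms member_le_sum[of j A x] unfolding abs_of_nat of_nat_le_iff total_count_def by simp
qed

context
  fixes r :: "'j \<Rightarrow> real" assumes rate: "\<And>j. r j \<ge> 0"
begin

definition poisson_field :: "'j set \<Rightarrow> ('j \<Rightarrow> nat) pmf" where
  "poisson_field A = Pi_pmf A 0 (\<lambda>j. poisson_law (r j))"

lemma integrable_poisson_field:
  assumes A: "finite A" and g: "exp_growth (total_count A) g"
  shows "integrable (poisson_field A) g"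
proof -
  obtain b where b: "b \<ge> 1" "\<And>x. \<bar>g x\<bar> \<le> b ^ Suc (total_count A x)"
    using g unfolding exp_growth_def by blast
  have "exp_growth (\<lambda>k. k) (\<lambda>k. b ^ k)"
    using b(1) by (intro exp_growthI[of b]) (auto intro: power_increasing)
  then have "integrable (poisson_field A) (\<lambda>x. b * (\<Prod>j\<in>A. b ^ x j))"
    unfolding poisson_field_def
    by (intro integrable_mult_right integrable_prod_Pi_pmf A integrable_poisson rate)
  then show ?thesis
  proof (rule Bochner_Integration.integrable_bound)
    show "AE x in poisson_field A. norm (g x) \<le> norm (b * (\<Prod>j\<in>A. b ^ x j))"
      using b by (simp add: total_count_def power_sum abs_mult flip: power_sum)
  qed simp
qed

context
  fixes A :: "'j set" and i :: 'j assumes A: "finite A" "i \<notin> A"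
begin

lemma exp_growth_slice:
  "exp_growth (total_count (insert i A)) g \<Longrightarrow> exp_growth (\<lambda>k. k) (\<lambda>k. g (x(i := k)))"
  by (rule exp_growth_compose[of "total_count (insert i A)" g _ _ "total_count A x"])
     (auto simp: total_count_insert A)

text \<open>
  Averaging one coordinate costs the constant factor \<open>E b ^ k\<close>; this keeps iterated expectations
  inside the growth class.
\<close>

lemma exp_growth_partial_expectation:
  assumes g: "exp_growth (total_count (insert i A)) g"
  shows "exp_growth (total_count A) (\<lambda>x. measure_pmf.expectation (poisson_law (r i)) (\<lambda>k. g (x(i := k))))"
proof -
  let ?E = "measure_pmf.expectation (poisson_law (r i))"
  obtain b where b: "b \<ge> 1" "\<And>x. \<bar>g x\<bar> \<le> b ^ Suc (total_count (insert i A) x)"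
    using g unfolding exp_growth_def by blast
  have gb: "exp_growth (\<lambda>k. k) (\<lambda>k. b ^ k)"
    using b(1) by (intro exp_growthI[of b]) (auto intro: power_increasing)
  show ?thesis
  proof (rule exp_growth_bound)
    show "exp_growth (total_count A) (\<lambda>x. b ^ Suc (total_count A x) * ?E (\<lambda>k. b ^ k))"
      using b(1) by (intro exp_growth_mult exp_growth_const exp_growthI[of b]) auto
    fix x
    have "\<bar>?E (\<lambda>k. g (x(i := k)))\<bar> \<le> ?E (\<lambda>k. \<bar>g (x(i := k))\<bar>)" by (rule integral_abs_bound)
    also have "\<dots> \<le> ?E (\<lambda>k. b ^ Suc (total_count A x) * b ^ k)"
    proof (intro integral_mono integrable_mult_right integrable_abs integrable_poisson rate exp_growth_slice g gb)
      show "\<bar>g (x(i := k))\<bar> \<le> b ^ Suc (total_count A x) * b ^ k" for k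
        using b(2)[of "x(i := k)"] by (simp add: total_count_insert[OF A] power_add mult_ac)
    qed
    also have "\<dots> = b ^ Suc (total_count A x) * ?E (\<lambda>k. b ^ k)" by simp
    finally show "\<bar>?E (\<lambda>k. g (x(i := k)))\<bar> \<le> \<bar>b ^ Suc (total_count A x) * ?E (\<lambda>k. b ^ k)\<bar>" by linarith
  qed
qed

lemma expectation_poisson_field_insert:
  assumes g: "exp_growth (total_count (insert i A)) g"
  shows "measure_pmf.expectation (poisson_field (insert i A)) g
    = measure_pmf.expectation (poisson_field A)
        (\<lambda>x. measure_pmf.expectation (poisson_law (r i)) (\<lambda>k. g (x(i := k))))"
proof -
  have ga: "exp_growth (total_count (insert i A)) (\<lambda>x. \<bar>g x\<bar>)" by (rule exp_growth_bound[OF g]) simp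
  have eq: "poisson_field (insert i A)
      = map_pmf (\<lambda>(x, k). x(i := k)) (pair_pmf (poisson_field A) (poisson_law (r i)))"
    unfolding poisson_field_def
    by (subst Pi_pmf_insert[OF A], subst pair_commute_pmf) (simp add: pmf.map_comp o_def case_prod_unfold)
  have "integrable (poisson_field (insert i A)) g" using A g by (intro integrable_poisson_field) auto
  then have int: "integrable (pair_pmf (poisson_field A) (poisson_law (r i))) (\<lambda>(x, k). g (x(i := k)))"
    unfolding eq by (simp add: integrable_map_pmf_eq case_prod_unfold)
  show ?thesis unfolding eq integral_map_pmf
    using expectation_pair_pmf[OF int] A
    by (simp add: case_prod_unfold integrable_poisson[OF rate exp_growth_slice[OF g]]
        integrable_poisson_field[OF A(1) exp_growth_partial_expectation[OF g]]
        integrable_poisson_field[OF A(1) exp_growth_partial_expectation[OF ga]])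
qed

end

lemma poisson_field_mecke:
  assumes A: "finite A" "i \<in> A" and g: "exp_growth (total_count A) g"
  shows "measure_pmf.expectation (poisson_field A) (\<lambda>x. real (x i) * g x)
    = r i * measure_pmf.expectation (poisson_field A) (\<lambda>x. g (add_point i x))"
proof -
  define A' where "A' = A - {i}"
  have A': "A = insert i A'" "finite A'" "i \<notin> A'" using A by (auto simp: A'_def)
  have g1: "exp_growth (total_count (insert i A')) (\<lambda>x. real (x i) * g x)"
    using A g unfolding A'(1)[symmetric] by (intro exp_growth_mult exp_growth_component)
  have g2: "exp_growth (total_count (insert i A')) (\<lambda>x. g (add_point i x))"
    unfolding A'(1)[symmetric] by (rule exp_growth_add_point[OF A(1) g])
  have g3: "exp_growth (total_count (insert i A')) g" using g A' by simp
  show ?thesis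
    unfolding A'(1) expectation_poisson_field_insert[OF A'(2,3) g1] expectation_poisson_field_insert[OF A'(2,3) g2]
    using poisson_mecke[OF rate exp_growth_slice[OF A'(2,3) g3]]
    by (simp add: add_point_def)
qed

text \<open>
  Tensorization. Averaging the new coordinate splits the entropy into the mean conditional entropy,
  handled by the one-dimensional inequality, and the entropy of the averaged function \<open>F\<close>, handled by
  induction; in the latter Jensen's inequality moves the divergence back inside the average.
\<close>

lemma poisson_field_entropy:
  assumes "finite A" "log_growth (total_count A) f"
  defines "E \<equiv> measure_pmf.expectation (poisson_field A)"
  shows "E (\<lambda>x. f x * ln (f x)) - E f * ln (E f)
    \<le> (\<Sum>j\<in>A. r j * E (\<lambda>x. bregman (f x) (f (add_point j x))))"
  using assms(1,2) unfolding E_def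
proof (induction A arbitrary: f rule: finite_induct)
  case empty
  then show ?case by (simp add: poisson_field_def)
next
  case (insert i A)
  note A = insert.hyps
  have pos: "f x > 0" for x using insert.prems by (simp add: log_growth_def)
  have f: "exp_growth (total_count (insert i A)) f" "exp_growth (total_count (insert i A)) (\<lambda>x. 1 / f x)"
    using insert.prems by (auto simp: log_growth_def)
  let ?P = "measure_pmf.expectation (poisson_field (insert i A))"
  let ?E = "measure_pmf.expectation (poisson_field A)"
  let ?e = "measure_pmf.expectation (poisson_law (r i))"
  note split = expectation_poisson_field_insert[OF A]
  note int = integrable_poisson_field[OF A(1)]
  note part = exp_growth_partial_expectation[OF A]
  define F where "F = (\<lambda>x. ?e (\<lambda>k. f (x(i := k))))"
  have slice: "log_growth (\<lambda>k. k) (\<lambda>k. f (x(i := k)))" for x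
    using exp_growth_slice[OF A f(1)] exp_growth_slice[OF A f(2)] pos by (simp add: log_growth_def)
  have intf: "integrable (poisson_law (r i)) (\<lambda>k. f (x(i := k)))" for x
    by (intro integrable_poisson rate exp_growth_slice[OF A f(1)])
  have F: "log_growth (total_count A) F"
    unfolding log_growth_def
  proof (intro conjI allI)
    show Fpos: "F x > 0" for x unfolding F_def
      using intf pos by (rule expectation_pos)
    show "exp_growth (total_count A) F" unfolding F_def by (rule part[OF f(1)])
    have "exp_growth (total_count A) (\<lambda>x. 1 / f (x(i := 0)))"
      by (rule exp_growth_compose[OF f(2), of _ _ 0]) (simp add: total_count_insert[OF A])
    \<comment> \<open>\<open>F x\<close> is at least the contribution \<open>exp (- r i) * f (x(i := 0))\<close> of the atom at \<open>0\<close>\<close>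
    then have "exp_growth (total_count A) (\<lambda>x. exp (r i) * (1 / f (x(i := 0))))"
      by (intro exp_growth_mult exp_growth_const)
    then show "exp_growth (total_count A) (\<lambda>x. 1 / F x)"
    proof (rule exp_growth_bound)
      fix x
      have "exp (- r i) * f (x(i := 0)) = ?e (\<lambda>k. f (x(i := 0)) * indicator {0} k)"
        by (simp add: measure_pmf_single pmf_poisson_law[OF rate])
      also have "\<dots> \<le> F x" unfolding F_def
        using pos by (intro integral_mono intf integrable_mult_right) (auto simp: indicator_def less_imp_le intro: measure_pmf.integrable_const_bound[of _ 1])
      finally have "1 / F x \<le> 1 / (exp (- r i) * f (x(i := 0)))"
        using pos by (intro divide_left_mono) (auto intro!: mult_pos_pos Fpos)
      then show "\<bar>1 / F x\<bar> \<le> \<bar>exp (r i) * (1 / f (x(i := 0)))\<bar>"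
        using Fpos[of x] pos by (simp add: exp_minus field_simps abs_of_pos)
    qed
  qed
  have gphi: "exp_growth (total_count (insert i A)) (\<lambda>x. f x * ln (f x))"
    by (rule log_growth_entropy[OF insert.prems])
  have gB: "exp_growth (total_count (insert i A)) (\<lambda>x. bregman (f x) (f (add_point j x)))" for j
    by (intro log_growth_bregman insert.prems log_growth_add_point) (use A in auto)
  have "?E (\<lambda>x. ?e (\<lambda>k. f (x(i := k)) * ln (f (x(i := k)))) - F x * ln (F x))
      \<le> ?E (\<lambda>x. r i * ?e (\<lambda>k. bregman (f (x(i := k))) (f (add_point i (x(i := k))))))"
  proof (intro integral_mono Bochner_Integration.integrable_diff integrable_mult_right int part gphi gB log_growth_entropy F)
    show "?e (\<lambda>k. f (x(i := k)) * ln (f (x(i := k)))) - F x * ln (F x)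
        \<le> r i * ?e (\<lambda>k. bregman (f (x(i := k))) (f (add_point i (x(i := k)))))" for x
      using poisson_entropy[OF rate slice[of x]] by (simp add: F_def add_point_def)
  qed
  also have "\<dots> = r i * ?P (\<lambda>x. bregman (f x) (f (add_point i x)))"
    by (simp add: split[OF gB])
  also have "?E (\<lambda>x. ?e (\<lambda>k. f (x(i := k)) * ln (f (x(i := k)))) - F x * ln (F x))
      = ?P (\<lambda>x. f x * ln (f x)) - ?E (\<lambda>x. F x * ln (F x))"
    unfolding split[OF gphi]
    by (intro Bochner_Integration.integral_diff int part gphi log_growth_entropy F)
  finally have 1: "?P (\<lambda>x. f x * ln (f x)) - ?E (\<lambda>x. F x * ln (F x))
      \<le> r i * ?P (\<lambda>x. bregman (f x) (f (add_point i x)))" .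
  have "?E (\<lambda>x. F x * ln (F x)) - ?E F * ln (?E F)
      \<le> (\<Sum>j\<in>A. r j * ?E (\<lambda>x. bregman (F x) (F (add_point j x))))"
    by (rule insert.IH[OF F])
  also have "\<dots> \<le> (\<Sum>j\<in>A. r j * ?P (\<lambda>x. bregman (f x) (f (add_point j x))))"
  proof (intro sum_mono mult_left_mono rate)
    fix j assume j: "j \<in> A"
    then have ji: "j \<noteq> i" using A by auto
    have upd: "add_point j (x(i := k)) = (add_point j x)(i := k)" for x k
      using ji by (auto simp: add_point_def)
    have "?E (\<lambda>x. bregman (F x) (F (add_point j x)))
      \<le> ?E (\<lambda>x. ?e (\<lambda>k. bregman (f (x(i := k))) (f (add_point j (x(i := k))))))"
    proof (intro integral_mono int part gB log_growth_bregman F log_growth_add_point A(1))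
      show "bregman (F x) (F (add_point j x)) \<le> ?e (\<lambda>k. bregman (f (x(i := k))) (f (add_point j (x(i := k)))))" for x
        unfolding F_def upd
      proof (rule bregman_jensen)
        show "integrable (poisson_law (r i)) (\<lambda>k. bregman (f (x(i := k))) (f ((add_point j x)(i := k))))"
          using exp_growth_slice[OF A gB[of j]] by (simp add: integrable_poisson[OF rate] upd)
      qed (auto intro: intf pos)
    qed
    then show "?E (\<lambda>x. bregman (F x) (F (add_point j x))) \<le> ?P (\<lambda>x. bregman (f x) (f (add_point j x)))"
      by (simp add: split[OF gB])
  qed
  also have "?E F = ?P f" by (simp add: split[OF f(1)] F_def)
  finally show ?case using 1 A by simp
qed

end

section \<open>The maximum of finitely many weighted Poisson sums\<close>


lemma exp_second_order:
  fixes w :: real shows "\<bar>exp w - 1 - w\<bar> \<le> w\<^sup>2 * exp \<bar>w\<bar>"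
proof -
  obtain s where s: "\<bar>s\<bar> \<le> \<bar>w\<bar>" "exp w = (\<Sum>m<2. w ^ m / fact m) + exp s / fact 2 * w ^ 2"
    using Maclaurin_exp_le[of w 2] by blast
  then have "exp w - 1 - w = exp s / 2 * w\<^sup>2" by (simp add: numeral_2_eq_2)
  then have "\<bar>exp w - 1 - w\<bar> = \<bar>exp s / 2 * w\<^sup>2\<bar>" by (rule arg_cong)
  also have "\<dots> = exp s / 2 * w\<^sup>2" by (simp add: abs_mult)
  also have "\<dots> \<le> exp \<bar>w\<bar> * w\<^sup>2"
  proof (intro mult_right_mono)
    have "exp s \<le> exp \<bar>w\<bar>" using s(1) by simp
    then show "exp s / 2 \<le> exp \<bar>w\<bar>" using exp_gt_zero[of s] by linarith
  qed simp
  finally show ?thesis by (simp add: mult.commute)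
qed

lemma abs_le_exp_abs: "\<bar>z\<bar> \<le> exp \<bar>z\<bar>" for z :: real
  using exp_ge_add_one_self[of "\<bar>z\<bar>"] by linarith

text \<open>
  The difference quotient differs from the claimed derivative by at most \<open>\<bar>h\<bar>\<close> times an integrable
  function, by the second order estimate of the exponential.
\<close>

lemma has_real_derivative_laplace:
  fixes p :: "'x pmf" and Z :: "'x \<Rightarrow> real"
  assumes int: "\<And>c. integrable p (\<lambda>x. exp (c * \<bar>Z x\<bar>))"
  shows "((\<lambda>t. measure_pmf.expectation p (\<lambda>x. exp (- t * Z x))) has_real_derivative
    - measure_pmf.expectation p (\<lambda>x. Z x * exp (- t * Z x))) (at t)"
proof -
  let ?E = "measure_pmf.expectation p"
  let ?F = "\<lambda>t. ?E (\<lambda>x. exp (- t * Z x))"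
  define K where "K = ?E (\<lambda>x. (Z x)\<^sup>2 * exp ((\<bar>t\<bar> + 1) * \<bar>Z x\<bar>))"
  have i0: "integrable p (\<lambda>x. exp (- s * Z x))" for s
    using int[of "\<bar>s\<bar>"]
  proof (rule Bochner_Integration.integrable_bound)
    have "- (s * Z x) \<le> \<bar>s\<bar> * \<bar>Z x\<bar>" for x by (metis abs_ge_minus_self abs_mult)
    then show "AE x in p. norm (exp (- s * Z x)) \<le> norm (exp (\<bar>s\<bar> * \<bar>Z x\<bar>))" by simp
  qed simp
  have i1: "integrable p (\<lambda>x. Z x * exp (- s * Z x))" for s
    using int[of "\<bar>s\<bar> + 1"]
  proof (rule Bochner_Integration.integrable_bound)
    have "\<bar>Z x\<bar> * exp (- s * Z x) \<le> exp \<bar>Z x\<bar> * exp (\<bar>s\<bar> * \<bar>Z x\<bar>)" for x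
      by (intro mult_mono abs_le_exp_abs) (auto simp: abs_mult[symmetric])
    then show "AE x in p. norm (Z x * exp (- s * Z x)) \<le> norm (exp ((\<bar>s\<bar> + 1) * \<bar>Z x\<bar>))"
      by (simp add: abs_mult algebra_simps exp_add)
  qed simp
  have i2: "integrable p (\<lambda>x. (Z x)\<^sup>2 * exp ((\<bar>t\<bar> + 1) * \<bar>Z x\<bar>))"
    using int[of "\<bar>t\<bar> + 3"]
  proof (rule Bochner_Integration.integrable_bound)
    have "(Z x)\<^sup>2 * exp ((\<bar>t\<bar> + 1) * \<bar>Z x\<bar>) \<le> (exp \<bar>Z x\<bar> * exp \<bar>Z x\<bar>) * exp ((\<bar>t\<bar> + 1) * \<bar>Z x\<bar>)" for x
    proof (intro mult_right_mono)
      have "\<bar>Z x\<bar> * \<bar>Z x\<bar> \<le> exp \<bar>Z x\<bar> * exp \<bar>Z x\<bar>" by (intro mult_mono abs_le_exp_abs) auto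
      then show "(Z x)\<^sup>2 \<le> exp \<bar>Z x\<bar> * exp \<bar>Z x\<bar>" by (simp add: power2_eq_square)
    qed simp
    also have "(exp \<bar>Z x\<bar> * exp \<bar>Z x\<bar>) * exp ((\<bar>t\<bar> + 1) * \<bar>Z x\<bar>) = exp ((\<bar>t\<bar> + 3) * \<bar>Z x\<bar>)" for x
      by (simp add: algebra_simps flip: exp_add)
    finally show "AE x in p. norm ((Z x)\<^sup>2 * exp ((\<bar>t\<bar> + 1) * \<bar>Z x\<bar>)) \<le> norm (exp ((\<bar>t\<bar> + 3) * \<bar>Z x\<bar>))"
      by simp
  qed simp
  have bound: "\<bar>(?F (t + h) - ?F t) / h + ?E (\<lambda>x. Z x * exp (- t * Z x))\<bar> \<le> \<bar>h\<bar> * K"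
    if h: "h \<noteq> 0" "\<bar>h\<bar> \<le> 1" for h
  proof -
    have pw: "\<bar>exp (- (t + h) * Z x) - exp (- t * Z x) + h * (Z x * exp (- t * Z x))\<bar>
        \<le> h\<^sup>2 * ((Z x)\<^sup>2 * exp ((\<bar>t\<bar> + 1) * \<bar>Z x\<bar>))" for x
    proof -
      have "exp (- (t + h) * Z x) - exp (- t * Z x) + h * (Z x * exp (- t * Z x))
          = exp (- t * Z x) * (exp (- h * Z x) - 1 - (- h * Z x))"
        by (simp add: algebra_simps flip: exp_add)
      then have "\<bar>exp (- (t + h) * Z x) - exp (- t * Z x) + h * (Z x * exp (- t * Z x))\<bar>
          = exp (- t * Z x) * \<bar>exp (- h * Z x) - 1 - (- h * Z x)\<bar>"
        by (simp only: abs_mult abs_exp_cancel)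
      also have "\<dots> \<le> exp (\<bar>t\<bar> * \<bar>Z x\<bar>) * ((- h * Z x)\<^sup>2 * exp \<bar>- h * Z x\<bar>)"
        by (intro mult_mono exp_second_order) (auto simp: abs_mult[symmetric])
      also have "\<dots> \<le> exp (\<bar>t\<bar> * \<bar>Z x\<bar>) * ((- h * Z x)\<^sup>2 * exp \<bar>Z x\<bar>)"
        using h(2) mult_right_mono[of "\<bar>h\<bar>" 1 "\<bar>Z x\<bar>"]
        by (intro mult_left_mono) (auto simp: abs_mult)
      also have "\<dots> = h\<^sup>2 * ((Z x)\<^sup>2 * exp ((\<bar>t\<bar> + 1) * \<bar>Z x\<bar>))"
        by (simp add: power_mult_distrib algebra_simps exp_add)
      finally show ?thesis .
    qed
    have "?F (t + h) - ?F t + h * ?E (\<lambda>x. Z x * exp (- t * Z x))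
        = ?E (\<lambda>x. exp (- (t + h) * Z x) - exp (- t * Z x) + h * (Z x * exp (- t * Z x)))"
      using i0[of "t + h"] i0[of t] i1[of t] by simp
    then have "\<bar>?F (t + h) - ?F t + h * ?E (\<lambda>x. Z x * exp (- t * Z x))\<bar>
        = \<bar>?E (\<lambda>x. exp (- (t + h) * Z x) - exp (- t * Z x) + h * (Z x * exp (- t * Z x)))\<bar>"
      by (rule arg_cong)
    also have "\<dots> \<le> ?E (\<lambda>x. \<bar>exp (- (t + h) * Z x) - exp (- t * Z x) + h * (Z x * exp (- t * Z x))\<bar>)"
      by (rule integral_abs_bound)
    also have "\<dots> \<le> ?E (\<lambda>x. h\<^sup>2 * ((Z x)\<^sup>2 * exp ((\<bar>t\<bar> + 1) * \<bar>Z x\<bar>)))"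
    proof (rule integral_mono)
      show "integrable p (\<lambda>x. \<bar>exp (- (t + h) * Z x) - exp (- t * Z x) + h * (Z x * exp (- t * Z x))\<bar>)"
        using i0[of "t + h"] i0[of t] i1[of t] by simp
      show "integrable p (\<lambda>x. h\<^sup>2 * ((Z x)\<^sup>2 * exp ((\<bar>t\<bar> + 1) * \<bar>Z x\<bar>)))"
        using i2 by simp
    qed (rule pw)
    also have "\<dots> = h\<^sup>2 * K" by (simp add: K_def)
    finally have *: "\<bar>?F (t + h) - ?F t + h * ?E (\<lambda>x. Z x * exp (- t * Z x))\<bar> \<le> h\<^sup>2 * K" .
    have "(?F (t + h) - ?F t) / h + ?E (\<lambda>x. Z x * exp (- t * Z x))
        = (?F (t + h) - ?F t + h * ?E (\<lambda>x. Z x * exp (- t * Z x))) / h"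
      using h by (simp add: add_divide_distrib)
    then have "\<bar>(?F (t + h) - ?F t) / h + ?E (\<lambda>x. Z x * exp (- t * Z x))\<bar>
        = \<bar>?F (t + h) - ?F t + h * ?E (\<lambda>x. Z x * exp (- t * Z x))\<bar> / \<bar>h\<bar>"
      by (simp only: abs_divide)
    also have "\<dots> \<le> h\<^sup>2 * K / \<bar>h\<bar>" using * by (intro divide_right_mono) auto
    also have "h\<^sup>2 * K / \<bar>h\<bar> = \<bar>h\<bar> * K"
      using h by (cases "h \<ge> 0") (simp_all add: power2_eq_square)
    finally show ?thesis .
  qed
  have "((\<lambda>h. (?F (t + h) - ?F t) / h - - ?E (\<lambda>x. Z x * exp (- t * Z x))) \<longlongrightarrow> 0) (at 0)"
  proof (rule Lim_null_comparison)
    show "((\<lambda>h. \<bar>h\<bar> * K) \<longlongrightarrow> 0) (at (0::real))" by (auto intro!: tendsto_eq_intros)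
    have "\<forall>\<^sub>F h in at (0::real). h \<noteq> 0 \<and> \<bar>h\<bar> \<le> 1"
      by (intro eventually_at[THEN iffD2] exI[of _ 1]) auto
    then show "\<forall>\<^sub>F h in at 0. norm ((?F (t + h) - ?F t) / h - - ?E (\<lambda>x. Z x * exp (- t * Z x))) \<le> \<bar>h\<bar> * K"
      by eventually_elim (use bound in simp)
  qed
  then show ?thesis unfolding DERIV_def by (rule LIM_zero_cancel)
qed

text \<open>
  The finite-dimensional model: \<open>x j\<close> is the number of points in the cell \<open>j\<close>, and \<open>a i j\<close> is the
  value of the \<open>i\<close>-th function on this cell.
\<close>

locale weighted_poisson_max =
  fixes r :: "'j \<Rightarrow> real" and A :: "'j set" and J :: "'i set" and a :: "'i \<Rightarrow> 'j \<Rightarrow> real"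
  assumes rate: "\<And>j. r j \<ge> 0"
    and A: "finite A" and J: "finite J" "J \<noteq> {}"
    and a: "\<And>i j. i \<in> J \<Longrightarrow> j \<in> A \<Longrightarrow> \<bar>a i j\<bar> \<le> 1"
begin

abbreviation "E \<equiv> measure_pmf.expectation (poisson_field r A)"

definition Y :: "'i \<Rightarrow> ('j \<Rightarrow> nat) \<Rightarrow> real" where
  "Y i x = (\<Sum>j\<in>A. a i j * (real (x j) - r j))"

definition Z :: "('j \<Rightarrow> nat) \<Rightarrow> real" where
  "Z x = Max ((\<lambda>i. Y i x) ` J)"

text \<open>
  A maximizer. It need not be unique, and any choice works.
\<close>

definition \<tau> :: "('j \<Rightarrow> nat) \<Rightarrow> 'i" where
  "\<tau> x = (SOME i. i \<in> J \<and> Z x = Y i x)"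

lemma \<tau>: "\<tau> x \<in> J" "Z x = Y (\<tau> x) x"
proof -
  have "Z x \<in> (\<lambda>i. Y i x) ` J" unfolding Z_def using J by (intro Max_in) auto
  then have "\<exists>i. i \<in> J \<and> Z x = Y i x" by auto
  from someI_ex[OF this] show "\<tau> x \<in> J" "Z x = Y (\<tau> x) x" by (auto simp: \<tau>_def)
qed

lemma Y_le_Z: "i \<in> J \<Longrightarrow> Y i x \<le> Z x"
  unfolding Z_def using J by (intro Max_ge) auto

lemma Y_add_point: "j \<in> A \<Longrightarrow> Y i (add_point j x) = Y i x + a i j"
  unfolding Y_def using A
  by (auto simp: sum.remove[of A j] add_point_def algebra_simps intro!: sum.cong)

text \<open>
  Both bounds come from comparing with a maximizer, before or after the additional point.
\<close>

lemma increment_bounds: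
  assumes "j \<in> A"
  shows "a (\<tau> x) j \<le> Z (add_point j x) - Z x" "Z (add_point j x) - Z x \<le> 1"
proof -
  show "a (\<tau> x) j \<le> Z (add_point j x) - Z x"
    using Y_le_Z[OF \<tau>(1)[of x], of "add_point j x"] \<tau>(2)[of x] assms by (simp add: Y_add_point)
  show "Z (add_point j x) - Z x \<le> 1"
    using Y_le_Z[OF \<tau>(1)[of "add_point j x"], of x] \<tau>(2)[of "add_point j x"]
      a[OF \<tau>(1)[of "add_point j x"] assms] assms by (simp add: Y_add_point)
qed

lemma abs_Y_le: "i \<in> J \<Longrightarrow> \<bar>Y i x\<bar> \<le> (1 + sum r A) * (1 + real (total_count A x))"
proof -
  assume i: "i \<in> J"
  have "\<bar>Y i x\<bar> \<le> (\<Sum>j\<in>A. \<bar>a i j * (real (x j) - r j)\<bar>)" unfolding Y_def by (rule sum_abs)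
  also have "\<dots> \<le> (\<Sum>j\<in>A. real (x j) + r j)"
  proof (rule sum_mono)
    fix j assume "j \<in> A"
    then have "\<bar>a i j * (real (x j) - r j)\<bar> \<le> 1 * (real (x j) + r j)"
      unfolding abs_mult using a[OF i] rate[of j] by (intro mult_mono) auto
    then show "\<bar>a i j * (real (x j) - r j)\<bar> \<le> real (x j) + r j" by simp
  qed
  also have "\<dots> = real (total_count A x) + sum r A" by (simp add: sum.distrib total_count_def)
  also have "\<dots> \<le> (1 + sum r A) * (1 + real (total_count A x))"
    using sum_nonneg[of A r] rate by (simp add: algebra_simps)
  finally show ?thesis .
qed

lemma abs_Z_le: "\<bar>Z x\<bar> \<le> (1 + sum r A) * (1 + real (total_count A x))"
  unfolding \<tau>(2) by (intro abs_Y_le \<tau>)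

lemma sum_rate_nonneg: "sum r A \<ge> 0"
  by (intro sum_nonneg rate)

lemma exp_growth_Z: "exp_growth (total_count A) Z"
proof (rule exp_growth_bound)
  show "exp_growth (total_count A) (\<lambda>x. (1 + sum r A) * (1 + real (total_count A x)))"
    by (intro exp_growth_mult exp_growth_add exp_growth_const exp_growth_weight)
  show "\<bar>Z x\<bar> \<le> \<bar>(1 + sum r A) * (1 + real (total_count A x))\<bar>" for x
    using abs_Z_le[of x] by linarith
qed

lemma exp_growth_exp_Z: "exp_growth (total_count A) (\<lambda>x. exp (t * Z x))"
  using sum_rate_nonneg by (intro exp_growth_exp[OF abs_Z_le]) auto

lemma log_growth_exp_Z: "log_growth (total_count A) (\<lambda>x. exp (t * Z x))"
  using exp_growth_exp_Z[of t] exp_growth_exp_Z[of "- t"]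
  by (simp add: log_growth_def exp_minus inverse_eq_divide)

lemma exp_growth_weight_at_maximizer:
  "j \<in> A \<Longrightarrow> exp_growth (total_count A) (\<lambda>x. a (\<tau> x) j)"
  by (rule exp_growth_bound[OF exp_growth_const[of _ 1]]) (use a \<tau> in auto)

lemmas integrable_growth = integrable_poisson_field[OF rate A]

text \<open>
  By the Mecke equation, \<open>r j\<close> times the expectation involving an added point is the expectation of
  \<open>x j\<close> times the decrement upon removing a point. This decrement is at most \<open>a (\<tau> x) j\<close>, and the sum
  of \<open>(x j - r j) * a (\<tau> x) j\<close> over \<open>j\<close> is exactly the maximum \<open>Z x\<close>.
\<close>

lemma self_bounding:
  "(\<Sum>j\<in>A. r j * (E (\<lambda>x. exp (t * Z (add_point j x)) * (Z (add_point j x) - Z x))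
      - E (\<lambda>x. exp (t * Z x) * a (\<tau> x) j))) \<le> E (\<lambda>x. Z x * exp (t * Z x))"
proof -
  define rem :: "'j \<Rightarrow> ('j \<Rightarrow> nat) \<Rightarrow> 'j \<Rightarrow> nat" where "rem = (\<lambda>j x. x(j := x j - 1))"
  have grem: "exp_growth (total_count A) (\<lambda>x. Z (rem j x))" for j
    by (rule exp_growth_compose[OF exp_growth_Z, of _ _ 0])
       (auto simp: rem_def total_count_def intro!: sum_mono)
  let ?g = "\<lambda>j x. exp (t * Z x) * (Z x - Z (rem j x))"
  have gg: "exp_growth (total_count A) (?g j)" for j
    by (intro exp_growth_mult exp_growth_diff exp_growth_exp_Z exp_growth_Z grem)
  note growth = exp_growth_mult exp_growth_diff exp_growth_exp_Z exp_growth_const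
    exp_growth_component[OF A] exp_growth_weight_at_maximizer
  have "r j * E (\<lambda>x. exp (t * Z (add_point j x)) * (Z (add_point j x) - Z x))
      \<le> E (\<lambda>x. exp (t * Z x) * (a (\<tau> x) j * real (x j)))" if j: "j \<in> A" for j
  proof -
    have "rem j (add_point j x) = x" for x by (auto simp: rem_def add_point_def)
    then have "r j * E (\<lambda>x. exp (t * Z (add_point j x)) * (Z (add_point j x) - Z x))
        = E (\<lambda>x. real (x j) * ?g j x)"
      using poisson_field_mecke[OF rate A j gg[of j]] by simp
    also have "\<dots> \<le> E (\<lambda>x. exp (t * Z x) * (a (\<tau> x) j * real (x j)))"
    proof (rule integral_mono)
      show "integrable (poisson_field r A) (\<lambda>x. real (x j) * ?g j x)"
        by (intro integrable_growth exp_growth_mult[OF exp_growth_component[OF A j] gg])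
      show "integrable (poisson_field r A) (\<lambda>x. exp (t * Z x) * (a (\<tau> x) j * real (x j)))"
        by (intro integrable_growth growth j)
      fix x
      show "real (x j) * ?g j x \<le> exp (t * Z x) * (a (\<tau> x) j * real (x j))"
      proof (cases "x j = 0")
        case False
        then have x: "add_point j (rem j x) = x" by (auto simp: rem_def add_point_def)
        have "Y (\<tau> x) x = Y (\<tau> x) (rem j x) + a (\<tau> x) j"
          using Y_add_point[OF j, of "\<tau> x" "rem j x"] by (simp add: x)
        then have "Z x - Z (rem j x) \<le> a (\<tau> x) j"
          using Y_le_Z[OF \<tau>(1)[of x], of "rem j x"] \<tau>(2)[of x] by linarith
        then have "(real (x j) * exp (t * Z x)) * (Z x - Z (rem j x))
            \<le> (real (x j) * exp (t * Z x)) * a (\<tau> x) j"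
          by (intro mult_left_mono) auto
        then show ?thesis by (simp add: mult_ac)
      qed simp
    qed
    finally show ?thesis .
  qed
  then have "(\<Sum>j\<in>A. r j * (E (\<lambda>x. exp (t * Z (add_point j x)) * (Z (add_point j x) - Z x))
      - E (\<lambda>x. exp (t * Z x) * a (\<tau> x) j)))
    \<le> (\<Sum>j\<in>A. E (\<lambda>x. exp (t * Z x) * (a (\<tau> x) j * real (x j))) - r j * E (\<lambda>x. exp (t * Z x) * a (\<tau> x) j))"
    by (intro sum_mono) (simp add: right_diff_distrib)
  also have "\<dots> = (\<Sum>j\<in>A. E (\<lambda>x. exp (t * Z x) * (a (\<tau> x) j * real (x j)) - r j * (exp (t * Z x) * a (\<tau> x) j)))"
  proof (rule sum.cong[OF refl])
    fix j assume j: "j \<in> A"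
    have "E (\<lambda>x. exp (t * Z x) * (a (\<tau> x) j * real (x j)) - r j * (exp (t * Z x) * a (\<tau> x) j))
      = E (\<lambda>x. exp (t * Z x) * (a (\<tau> x) j * real (x j))) - E (\<lambda>x. r j * (exp (t * Z x) * a (\<tau> x) j))"
      using j by (intro Bochner_Integration.integral_diff integrable_growth growth)
    then show "E (\<lambda>x. exp (t * Z x) * (a (\<tau> x) j * real (x j))) - r j * E (\<lambda>x. exp (t * Z x) * a (\<tau> x) j)
      = E (\<lambda>x. exp (t * Z x) * (a (\<tau> x) j * real (x j)) - r j * (exp (t * Z x) * a (\<tau> x) j))"
      by simp
  qed
  also have "\<dots> = E (\<lambda>x. \<Sum>j\<in>A. exp (t * Z x) * (a (\<tau> x) j * real (x j)) - r j * (exp (t * Z x) * a (\<tau> x) j))"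
    by (intro Bochner_Integration.integral_sum[symmetric] integrable_growth growth)
  also have "\<dots> = E (\<lambda>x. Z x * exp (t * Z x))"
  proof (rule arg_cong[of _ _ E], rule ext)
    fix x
    have "(\<Sum>j\<in>A. exp (t * Z x) * (a (\<tau> x) j * real (x j)) - r j * (exp (t * Z x) * a (\<tau> x) j))
        = exp (t * Z x) * Y (\<tau> x) x"
      unfolding Y_def sum_distrib_left by (intro sum.cong) (auto simp: algebra_simps)
    then show "(\<Sum>j\<in>A. exp (t * Z x) * (a (\<tau> x) j * real (x j)) - r j * (exp (t * Z x) * a (\<tau> x) j))
        = Z x * exp (t * Z x)" by (simp add: \<tau>(2)[symmetric] mult.commute)
  qed
  finally show ?thesis .
qed

lemma expectation_Y: assumes "i \<in> J" shows "E (Y i) = 0"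
proof -
  note growth = exp_growth_mult exp_growth_diff exp_growth_const exp_growth_component[OF A]
  have "E (Y i) = (\<Sum>j\<in>A. E (\<lambda>x. a i j * (real (x j) - r j)))"
    unfolding Y_def[abs_def] by (intro Bochner_Integration.integral_sum integrable_growth growth)
  also have "\<dots> = (\<Sum>j\<in>A. 0)"
  proof (rule sum.cong[OF refl])
    fix j assume j: "j \<in> A"
    have "E (\<lambda>x. real (x j)) = r j"
      using poisson_field_mecke[OF rate A j exp_growth_const[of _ 1]] by simp
    moreover have "E (\<lambda>x. real (x j) - r j) = E (\<lambda>x. real (x j)) - E (\<lambda>x. r j)"
      using j by (intro Bochner_Integration.integral_diff integrable_growth growth)
    ultimately show "E (\<lambda>x. a i j * (real (x j) - r j)) = 0" by simp
  qed
  finally show ?thesis by simp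
qed

lemma exp_growth_Y: "i \<in> J \<Longrightarrow> exp_growth (total_count A) (Y i)"
  unfolding Y_def[abs_def]
  by (intro exp_growth_sum exp_growth_mult exp_growth_diff exp_growth_const exp_growth_component[OF A])

lemma expectation_Z_nonneg: "E Z \<ge> 0"
proof -
  obtain i where i: "i \<in> J" using J by auto
  have "E (Y i) \<le> E Z" by (intro integral_mono integrable_growth exp_growth_Y exp_growth_Z Y_le_Z i)
  then show ?thesis by (simp add: expectation_Y i)
qed

text \<open>
  By the Mecke equation, since adding a point in the cell \<open>j\<close> shifts \<open>Y i\<close> by \<open>a i j\<close>.
\<close>

lemma variance_Y:
  assumes i: "i \<in> J" shows "E (\<lambda>x. (Y i x)\<^sup>2) = (\<Sum>j\<in>A. r j * (a i j)\<^sup>2)"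
proof -
  note growth = exp_growth_mult exp_growth_diff exp_growth_const exp_growth_component[OF A] exp_growth_Y[OF i]
  have "E (\<lambda>x. (Y i x)\<^sup>2) = E (\<lambda>x. \<Sum>j\<in>A. a i j * (real (x j) - r j) * Y i x)"
    unfolding sum_distrib_right[symmetric] by (simp add: Y_def power2_eq_square)
  also have "\<dots> = (\<Sum>j\<in>A. E (\<lambda>x. a i j * (real (x j) - r j) * Y i x))"
    by (intro Bochner_Integration.integral_sum integrable_growth growth)
  also have "\<dots> = (\<Sum>j\<in>A. r j * (a i j)\<^sup>2)"
  proof (rule sum.cong[OF refl])
    fix j assume j: "j \<in> A"
    have intY: "integrable (poisson_field r A) (Y i)" by (intro integrable_growth growth)
    have "E (\<lambda>x. real (x j) * Y i x) = r j * E (\<lambda>x. Y i x + a i j)"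
      using poisson_field_mecke[OF rate A j exp_growth_Y[OF i]] by (simp add: Y_add_point[OF j])
    also have "E (\<lambda>x. Y i x + a i j) = a i j" using intY by (simp add: expectation_Y[OF i])
    finally have 1: "E (\<lambda>x. real (x j) * Y i x) = r j * a i j" .
    have "E (\<lambda>x. real (x j) * Y i x - r j * Y i x) = E (\<lambda>x. real (x j) * Y i x) - E (\<lambda>x. r j * Y i x)"
      using j by (intro Bochner_Integration.integral_diff integrable_growth growth)
    then have "E (\<lambda>x. real (x j) * Y i x - r j * Y i x) = r j * a i j"
      using 1 by (simp add: expectation_Y[OF i])
    moreover have "E (\<lambda>x. a i j * (real (x j) - r j) * Y i x) = a i j * E (\<lambda>x. real (x j) * Y i x - r j * Y i x)"
      by (simp add: left_diff_distrib mult.assoc)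
    ultimately show "E (\<lambda>x. a i j * (real (x j) - r j) * Y i x) = r j * (a i j)\<^sup>2"
      by (simp add: power2_eq_square)
  qed
  finally show ?thesis .
qed

text \<open>
  The entropy of \<open>exp (- t * Z x)\<close> is \<open>- t\<close> times the expectation on the left-hand side, minus
  \<open>F * ln F\<close>. It is bounded by the divergences of adding a point, these by \<open>increment_bound\<close>, and the
  two resulting sums by the variance and by self-bounding; the latter adds \<open>2 * p\<close> times the same
  expectation.
\<close>

lemma entropy_bound:
  fixes t V :: real
  defines "p \<equiv> psi (3 * t) / 9" and "q \<equiv> (exp (3 * t) - 1) / 3"
  defines "F \<equiv> E (\<lambda>x. exp (- t * Z x))"
  assumes t: "t \<ge> 0" and V: "\<And>i. i \<in> J \<Longrightarrow> E (\<lambda>x. (Y i x)\<^sup>2) \<le> V"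
  shows "- (t + 2 * p) * E (\<lambda>x. Z x * exp (- t * Z x)) \<le> F * ln F + p * (1 + 2 * q) * V * F"
proof -
  let ?f = "\<lambda>x. exp (- t * Z x)"
  let ?D = "\<lambda>j x. Z (add_point j x) - Z x"
  have p: "p \<ge> 0" and q: "q \<ge> 0" using psi_nonneg t by (auto simp: p_def q_def)
  note growth = exp_growth_mult exp_growth_diff exp_growth_add exp_growth_exp_Z exp_growth_const exp_growth_Z
    exp_growth_weight_at_maximizer exp_growth_add_point[OF A exp_growth_Z] exp_growth_add_point[OF A exp_growth_exp_Z]
  have "E (\<lambda>x. ?f x * ln (?f x)) - F * ln F
      \<le> (\<Sum>j\<in>A. r j * E (\<lambda>x. bregman (?f x) (?f (add_point j x))))"
    unfolding F_def by (rule poisson_field_entropy[OF rate A log_growth_exp_Z])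
  also have "\<dots> \<le> (\<Sum>j\<in>A. r j * (2 * p * (E (\<lambda>x. ?f (add_point j x) * ?D j x) - E (\<lambda>x. ?f x * a (\<tau> x) j))
      + p * (1 + 2 * q) * E (\<lambda>x. ?f x * (a (\<tau> x) j * a (\<tau> x) j))))"
  proof (intro sum_mono mult_left_mono rate)
    fix j assume j: "j \<in> A"
    have i1: "integrable (poisson_field r A) (\<lambda>x. ?f (add_point j x) * ?D j x)"
      and i2: "integrable (poisson_field r A) (\<lambda>x. ?f x * a (\<tau> x) j)"
      and i3: "integrable (poisson_field r A) (\<lambda>x. ?f x * (a (\<tau> x) j * a (\<tau> x) j))"
      by (intro integrable_growth growth j)+
    have "E (\<lambda>x. bregman (?f x) (?f (add_point j x)))
        \<le> E (\<lambda>x. 2 * p * (?f (add_point j x) * ?D j x - ?f x * a (\<tau> x) j)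
              + p * (1 + 2 * q) * (?f x * (a (\<tau> x) j * a (\<tau> x) j)))"
    proof (intro integral_mono)
      show "integrable (poisson_field r A) (\<lambda>x. bregman (?f x) (?f (add_point j x)))"
        by (intro integrable_growth log_growth_bregman log_growth_exp_Z log_growth_add_point[OF A])
      show "integrable (poisson_field r A) (\<lambda>x. 2 * p * (?f (add_point j x) * ?D j x - ?f x * a (\<tau> x) j)
              + p * (1 + 2 * q) * (?f x * (a (\<tau> x) j * a (\<tau> x) j)))"
        using i1 i2 i3 by (intro Bochner_Integration.integrable_add integrable_mult_right Bochner_Integration.integrable_diff)
      fix x
      have e: "?f (add_point j x) = ?f x * exp (- (t * ?D j x))"
        by (simp add: algebra_simps flip: exp_add)
      have "- (t * Z (add_point j x)) - - (t * Z x) = - (t * ?D j x)" by (simp add: algebra_simps)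
      then have "ln (?f (add_point j x) / ?f x) = - (t * ?D j x)"
        by (simp flip: exp_diff)
      then have "bregman (?f x) (?f (add_point j x)) = ?f x * psi (- (t * ?D j x))"
        unfolding bregman_def psi_def e by (simp add: algebra_simps)
      also have "\<dots> \<le> ?f x * (2 * p * (?D j x * exp (- (t * ?D j x)) - a (\<tau> x) j) + p * (1 + 2 * q) * (a (\<tau> x) j)\<^sup>2)"
        unfolding p_def q_def using a[OF \<tau>(1) j, of x] increment_bounds[OF j, of x] t
        by (intro mult_left_mono increment_bound) auto
      also have "\<dots> = 2 * p * (?f (add_point j x) * ?D j x - ?f x * a (\<tau> x) j)
              + p * (1 + 2 * q) * (?f x * (a (\<tau> x) j * a (\<tau> x) j))"
        unfolding e by (simp add: algebra_simps power2_eq_square)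
      finally show "bregman (?f x) (?f (add_point j x)) \<le> 2 * p * (?f (add_point j x) * ?D j x - ?f x * a (\<tau> x) j)
              + p * (1 + 2 * q) * (?f x * (a (\<tau> x) j * a (\<tau> x) j))" .
    qed
    also have "\<dots> = 2 * p * (E (\<lambda>x. ?f (add_point j x) * ?D j x) - E (\<lambda>x. ?f x * a (\<tau> x) j))
      + p * (1 + 2 * q) * E (\<lambda>x. ?f x * (a (\<tau> x) j * a (\<tau> x) j))"
      using i1 i2 i3 by (simp only: Bochner_Integration.integral_add Bochner_Integration.integral_diff
          integral_mult_right_zero integrable_mult_right Bochner_Integration.integrable_diff)
    finally show "E (\<lambda>x. bregman (?f x) (?f (add_point j x))) \<le> \<dots>" .
  qed
  also have "\<dots> = 2 * p * (\<Sum>j\<in>A. r j * (E (\<lambda>x. ?f (add_point j x) * ?D j x) - E (\<lambda>x. ?f x * a (\<tau> x) j)))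
      + p * (1 + 2 * q) * (\<Sum>j\<in>A. r j * E (\<lambda>x. ?f x * (a (\<tau> x) j * a (\<tau> x) j)))"
    unfolding sum_distrib_left sum.distrib[symmetric] by (intro sum.cong) (auto simp: algebra_simps)
  also have "(\<Sum>j\<in>A. r j * E (\<lambda>x. ?f x * (a (\<tau> x) j * a (\<tau> x) j)))
      = E (\<lambda>x. \<Sum>j\<in>A. r j * (?f x * (a (\<tau> x) j * a (\<tau> x) j)))"
  proof -
    have "E (\<lambda>x. \<Sum>j\<in>A. r j * (?f x * (a (\<tau> x) j * a (\<tau> x) j)))
        = (\<Sum>j\<in>A. E (\<lambda>x. r j * (?f x * (a (\<tau> x) j * a (\<tau> x) j))))"
      by (intro Bochner_Integration.integral_sum integrable_growth growth)
    then show ?thesis by simp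
  qed
  also have "\<dots> \<le> E (\<lambda>x. V * ?f x)"
  proof (intro integral_mono integrable_growth growth exp_growth_sum)
    fix x
    have "(\<Sum>j\<in>A. r j * (a (\<tau> x) j)\<^sup>2) \<le> V"
      using V[OF \<tau>(1)[of x]] variance_Y[OF \<tau>(1)[of x]] by simp
    then have "?f x * (\<Sum>j\<in>A. r j * (a (\<tau> x) j)\<^sup>2) \<le> ?f x * V" by (intro mult_left_mono) auto
    then show "(\<Sum>j\<in>A. r j * (?f x * (a (\<tau> x) j * a (\<tau> x) j))) \<le> V * ?f x"
      by (simp add: sum_distrib_left power2_eq_square mult_ac)
  qed
  also have "E (\<lambda>x. V * ?f x) = V * F" by (simp add: F_def)
  also have "(\<Sum>j\<in>A. r j * (E (\<lambda>x. ?f (add_point j x) * ?D j x) - E (\<lambda>x. ?f x * a (\<tau> x) j)))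
      \<le> E (\<lambda>x. Z x * ?f x)"
    using self_bounding[of "- t"] by simp
  finally have "E (\<lambda>x. ?f x * ln (?f x)) - F * ln F \<le> 2 * p * E (\<lambda>x. Z x * ?f x) + p * (1 + 2 * q) * (V * F)"
    using p q by (auto simp: mult_left_mono)
  moreover have "E (\<lambda>x. ?f x * ln (?f x)) = E (\<lambda>x. - t * (Z x * ?f x))"
    by (simp add: mult_ac)
  then have "E (\<lambda>x. ?f x * ln (?f x)) = - t * E (\<lambda>x. Z x * ?f x)" by simp
  ultimately show ?thesis by (simp add: algebra_simps)
qed

text \<open>
  Dividing \<open>entropy_bound\<close> by \<open>F t\<close> gives a linear differential inequality for \<open>ln (F t)\<close>. The function
  \<open>b t = (exp (3 * t) - 3 * t - 1) / 9\<close> has derivative \<open>q = (exp (3 * t) - 1) / 3\<close> and satisfies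
  \<open>(t + 2 * p) * q - b t = p * (1 + 2 * q)\<close>, which is the coefficient of \<open>V\<close>. So the
  difference \<open>u\<close> of the two sides of the claim satisfies the homogeneous inequality, up to a multiple of
  \<open>E Z\<close> of the favourable sign.
\<close>

lemma log_laplace_bound:
  assumes t: "t \<ge> 0" and V: "\<And>i. i \<in> J \<Longrightarrow> E (\<lambda>x. (Y i x)\<^sup>2) \<le> V"
  shows "ln (E (\<lambda>x. exp (- t * Z x))) \<le> - t * E Z + (2 * E Z + V) / 9 * (exp (3 * t) - 3 * t - 1)"
proof -
  define \<upsilon> where "\<upsilon> = 2 * E Z + V"
  define F where "F = (\<lambda>t. E (\<lambda>x. exp (- t * Z x)))"
  define H where "H = (\<lambda>t. E (\<lambda>x. Z x * exp (- t * Z x)))"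
  define u where "u = (\<lambda>t. ln (F t) + t * E Z - \<upsilon> / 9 * (exp (3 * t) - 3 * t - 1))"
  define u' where "u' = (\<lambda>t. - H t / F t + E Z - \<upsilon> * ((exp (3 * t) - 1) / 3))"
  have Fpos: "F t > 0" for t
    unfolding F_def by (intro expectation_pos integrable_growth exp_growth_exp_Z) simp
  have "integrable (poisson_field r A) (\<lambda>x. exp (c * \<bar>Z x\<bar>))" for c
    using abs_Z_le sum_rate_nonneg by (intro integrable_growth exp_growth_exp[of _ "1 + sum r A"]) auto
  from has_real_derivative_laplace[OF this]
  have F': "(F has_real_derivative - H t) (at t)" for t unfolding F_def H_def .
  have deriv: "(u has_real_derivative u' t) (at t)" for t
    unfolding u_def u'_def using Fpos[of t]
    by (auto intro!: derivative_eq_intros F' simp: field_simps)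
  have u0: "u 0 = 0" "u' 0 = 0" by (auto simp: u_def u'_def F_def H_def)
  have ineq: "(t + 2 * (psi (3 * t) / 9)) * u' t \<le> u t" if t: "t > 0" for t
  proof -
    define p where "p = psi (3 * t) / 9"
    define q where "q = (exp (3 * t) - 1) / 3"
    have p: "p \<ge> 0" and q: "q \<ge> 0" using psi_nonneg t by (auto simp: p_def q_def)
    have tq: "t * q = p + (exp (3 * t) - 3 * t - 1) / 9"
      unfolding p_def q_def psi_def by (simp add: field_simps)
    have "- (t + 2 * p) * H t \<le> F t * ln (F t) + p * (1 + 2 * q) * V * F t"
      using entropy_bound[of t V] t V unfolding F_def H_def p_def q_def by simp
    then have "- (t + 2 * p) * H t / F t \<le> (F t * ln (F t) + p * (1 + 2 * q) * V * F t) / F t"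
      using Fpos[of t] by (intro divide_right_mono) auto
    also have "\<dots> = ln (F t) + p * (1 + 2 * q) * V" using Fpos[of t] by (simp add: add_divide_distrib)
    finally have 1: "- (t + 2 * p) * H t / F t \<le> ln (F t) + p * (1 + 2 * q) * V" .
    have "(t + 2 * p) * u' t = - (t + 2 * p) * H t / F t + (t + 2 * p) * E Z - \<upsilon> * (t * q + 2 * p * q)"
      unfolding u'_def q_def[symmetric] by (simp add: algebra_simps add_divide_distrib diff_divide_distrib)
    also have "\<dots> \<le> ln (F t) + p * (1 + 2 * q) * V + (t + 2 * p) * E Z - \<upsilon> * (t * q + 2 * p * q)"
      using 1 by simp
    also have "\<dots> = u t - 4 * (p * q * E Z)"
      unfolding u_def tq unfolding \<upsilon>_def by (simp add: algebra_simps)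
    also have "\<dots> \<le> u t" using p q expectation_Z_nonneg by simp
    finally show ?thesis unfolding p_def .
  qed
  have pos: "2 * (psi (3 * t) / 9) > 0" if "t > 0" for t using psi_pos[of "3 * t"] that by simp
  have "u t \<le> 0"
    by (rule nonpos_of_differential_inequality[where u = u and u' = u' and \<alpha> = "\<lambda>t. 2 * (psi (3 * t) / 9)"])
       (fact deriv u0 ineq pos t)+
  then show ?thesis by (simp add: u_def \<upsilon>_def F_def)
qed

end

section \<open>Discretization of the point process\<close>


lemma countable_finite_support: "countable {x :: nat \<Rightarrow> nat. \<forall>i\<ge>n. x i = 0}"
proof -
  have "{x :: nat \<Rightarrow> nat. \<forall>i\<ge>n. x i = 0}
      \<subseteq> (\<lambda>f i. if i < n then f i else 0) ` (PiE {..<n} (\<lambda>_. UNIV))"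
  proof
    fix x :: "nat \<Rightarrow> nat" assume "x \<in> {x. \<forall>i\<ge>n. x i = 0}"
    then have "x = (\<lambda>i. if i < n then restrict x {..<n} i else 0)" by (auto simp: fun_eq_iff)
    then show "x \<in> (\<lambda>f i. if i < n then f i else 0) ` (PiE {..<n} (\<lambda>_. UNIV))"
      by (rule image_eqI[of _ _ "restrict x {..<n}"]) auto
  qed
  then show ?thesis by (rule countable_subset) (intro countable_image countable_PiE; simp)
qed

text \<open>
  Both laws live on the countable set \<open>\<Omega>\<close> of configurations supported in \<open>{..<n}\<close>, so that it
  suffices to compare atoms; independence factorizes them.
\<close>

lemma (in prob_space) distr_independent_poisson:
  fixes c :: "'a \<Rightarrow> nat \<Rightarrow> nat" and r :: "nat \<Rightarrow> real"
  assumes n: "n > 0" and r: "\<And>i. r i \<ge> 0"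
    and indep: "indep_vars (\<lambda>_. borel) (\<lambda>i \<omega>. real (c \<omega> i)) {..<n}"
    and law: "\<And>i k. i < n \<Longrightarrow> prob {\<omega>\<in>space M. c \<omega> i = k} = r i ^ k / fact k * exp (- r i)"
    and c0: "\<And>\<omega> i. \<omega> \<in> space M \<Longrightarrow> i \<ge> n \<Longrightarrow> c \<omega> i = 0"
  shows "c \<in> M \<rightarrow>\<^sub>M count_space UNIV"
    and "distr M (count_space UNIV) c = measure_pmf (poisson_field r {..<n})"
proof -
  define \<Omega> where "\<Omega> = {x :: nat \<Rightarrow> nat. \<forall>i\<ge>n. x i = 0}"
  have \<Omega>: "countable \<Omega>" unfolding \<Omega>_def by (rule countable_finite_support)
  have X: "random_variable borel (\<lambda>\<omega>. real (c \<omega> i))" if "i < n" for i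
    using indep that unfolding indep_vars_def by auto
  have fiber: "c -` {x} \<inter> space M = (\<Inter>i\<in>{..<n}. (\<lambda>\<omega>. real (c \<omega> i)) -` {real (x i)} \<inter> space M)"
    if "x \<in> \<Omega>" for x
  proof (intro equalityI subsetI)
    fix \<omega> assume \<omega>: "\<omega> \<in> (\<Inter>i\<in>{..<n}. (\<lambda>\<omega>. real (c \<omega> i)) -` {real (x i)} \<inter> space M)"
    have *: "c \<omega> i = x i" "\<omega> \<in> space M" if "i < n" for i
      using INT_D[OF \<omega>, of i] that by auto
    have \<omega>: "\<omega> \<in> space M" using *(2)[OF n] .
    have "c \<omega> i = x i" for i
      using *(1)[of i] c0[OF \<omega>, of i] \<open>x \<in> \<Omega>\<close> by (cases "i < n") (auto simp: \<Omega>_def)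
    then have "c \<omega> = x" by (rule ext)
    then show "\<omega> \<in> c -` {x} \<inter> space M" using \<omega> by simp
  qed auto
  have fiber_sets: "c -` {x} \<inter> space M \<in> sets M" if "x \<in> \<Omega>" for x
    unfolding fiber[OF that] using n X by (intro sets.finite_INT) (auto intro!: measurable_sets[of _ M borel])
  show meas: "c \<in> M \<rightarrow>\<^sub>M count_space UNIV"
  proof (rule measurableI)
    fix B :: "(nat \<Rightarrow> nat) set"
    have "c -` B \<inter> space M = (\<Union>x\<in>B \<inter> \<Omega>. c -` {x} \<inter> space M)"
      using c0 by (auto simp: \<Omega>_def)
    also have "\<dots> \<in> sets M"
      using \<Omega> by (intro sets.countable_UN'' fiber_sets) (auto intro: countable_Int2)
    finally show "c -` B \<inter> space M \<in> sets M" .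
  qed simp
  show "distr M (count_space UNIV) c = measure_pmf (poisson_field r {..<n})"
  proof (rule measure_eqI_countable_AE[OF _ _ _ _ \<Omega>])
    show "AE x in distr M (count_space UNIV) c. x \<in> \<Omega>"
      using c0 by (subst AE_distr_iff[OF meas]) (auto simp: \<Omega>_def)
    show "AE x in measure_pmf (poisson_field r {..<n}). x \<in> \<Omega>"
      using set_Pi_pmf_subset[of "{..<n}" 0 "\<lambda>j. poisson_law (r j)"]
      by (auto simp: AE_measure_pmf_iff \<Omega>_def poisson_field_def[OF r])
    fix x assume x: "x \<in> \<Omega>"
    have "emeasure (distr M (count_space UNIV) c) {x} = emeasure M (c -` {x} \<inter> space M)"
      by (intro emeasure_distr meas) auto
    also have "\<dots> = ennreal (prob (c -` {x} \<inter> space M))" by (rule emeasure_eq_measure)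
    also have "prob (c -` {x} \<inter> space M) = (\<Prod>i<n. prob ((\<lambda>\<omega>. real (c \<omega> i)) -` {real (x i)} \<inter> space M))"
      unfolding fiber[OF x] using n by (intro indep_varsD_finite[OF indep]) auto
    also have "\<dots> = (\<Prod>i<n. pmf (poisson_law (r i)) (x i))"
    proof (rule prod.cong[OF refl])
      fix i assume i: "i \<in> {..<n}"
      have "(\<lambda>\<omega>. real (c \<omega> i)) -` {real (x i)} \<inter> space M = {\<omega>\<in>space M. c \<omega> i = x i}" by auto
      then show "prob ((\<lambda>\<omega>. real (c \<omega> i)) -` {real (x i)} \<inter> space M) = pmf (poisson_law (r i)) (x i)"
        using law[of i "x i"] i by (simp add: pmf_poisson_law r)
    qed
    also have "\<dots> = pmf (poisson_field r {..<n}) x"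
      unfolding poisson_field_def[OF r] using x by (subst pmf_Pi') (auto simp: \<Omega>_def)
    finally show "emeasure (distr M (count_space UNIV) c) {x} = emeasure (measure_pmf (poisson_field r {..<n})) {x}"
      by (simp add: emeasure_pmf_single)
  qed simp_all
qed

text \<open>
  Rounding all functions down to multiples of \<open>1 / m\<close>. The cells are indexed by the vectors \<open>e j\<close> of
  rounded values; empty cells are allowed.
\<close>

lemma simultaneous_discretization:
  fixes s :: "'i \<Rightarrow> 'x \<Rightarrow> real" and m :: nat
  assumes J: "finite J" and m: "m > 0"
    and s: "\<And>i. i \<in> J \<Longrightarrow> s i \<in> borel_measurable L" "\<And>i x. i \<in> J \<Longrightarrow> \<bar>s i x\<bar> \<le> 1"
  obtains n :: nat and A :: "nat \<Rightarrow> 'x set" and a :: "'i \<Rightarrow> nat \<Rightarrow> real"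
  where "n > 0" "\<And>j. j < n \<Longrightarrow> A j \<in> sets L" "disjoint_family_on A {..<n}"
    "\<And>i j. i \<in> J \<Longrightarrow> j < n \<Longrightarrow> \<bar>a i j\<bar> \<le> 1"
    "\<And>i x. i \<in> J \<Longrightarrow> x \<in> space L \<Longrightarrow> \<bar>s i x - (\<Sum>j<n. a i j * indicator (A j) x)\<bar> \<le> 1 / real m"
proof -
  define T where "T = PiE J (\<lambda>_. {- int m..int m})"
  define n where "n = card T"
  have T: "finite T" unfolding T_def using J by (intro finite_PiE) auto
  have "T \<noteq> {}" unfolding T_def by (auto simp: PiE_eq_empty_iff)
  then have n: "n > 0" using T by (simp add: n_def card_gt_0_iff)
  obtain e where e: "bij_betw e {..<n} T"
    using ex_bij_betw_nat_finite[OF T] by (auto simp: n_def lessThan_atLeast0)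
  define A where "A = (\<lambda>j. {x\<in>space L. \<forall>i\<in>J. \<lfloor>real m * s i x\<rfloor> = e j i})"
  define a where "a = (\<lambda>i j. real_of_int (e j i) / real m)"
  have eT: "e j \<in> T" if "j < n" for j using e that by (auto simp: bij_betw_def)
  have range: "\<lfloor>real m * s i x\<rfloor> \<in> {- int m..int m}" if "i \<in> J" for i x
  proof -
    have "- 1 * real m \<le> s i x * real m" "s i x * real m \<le> 1 * real m"
      using s(2)[OF that, of x] by (intro mult_right_mono; auto simp: abs_le_iff)+
    then have "- real m \<le> real m * s i x" "real m * s i x \<le> real m" by (auto simp: mult.commute)
    then have "- int m \<le> \<lfloor>real m * s i x\<rfloor>" "\<lfloor>real m * s i x\<rfloor> \<le> int m"
      by (auto simp: le_floor_iff floor_le_iff)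
    then show ?thesis by simp
  qed
  show thesis
  proof (rule that[OF n, of A a])
    fix j assume "j < n"
    have "A j = (\<Inter>i\<in>J. {x\<in>space L. \<lfloor>real m * s i x\<rfloor> = e j i}) \<inter> space L"
      unfolding A_def by auto
    moreover have "{x\<in>space L. \<lfloor>real m * s i x\<rfloor> = e j i} \<in> sets L" if "i \<in> J" for i
      using s(1)[OF that] by measurable
    ultimately show "A j \<in> sets L" using J by (cases "J = {}") auto
  next
    show "disjoint_family_on A {..<n}"
    proof (unfold disjoint_family_on_def, intro ballI impI)
      fix j k assume jk: "j \<in> {..<n}" "k \<in> {..<n}" "j \<noteq> k"
      show "A j \<inter> A k = {}"
      proof (rule ccontr)
        assume "A j \<inter> A k \<noteq> {}"
        then obtain x where "x \<in> A j" "x \<in> A k" by auto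
        then have "e j i = e k i" if "i \<in> J" for i using that by (auto simp: A_def)
        then have "e j = e k" using eT jk unfolding T_def by (intro PiE_ext[of "e j" J _ "e k"]) auto
        then show False using e jk by (auto simp: bij_betw_def inj_on_def)
      qed
    qed
  next
    fix i j assume ij: "i \<in> J" "j < n"
    then have "e j i \<in> {- int m..int m}" using eT[OF ij(2)] by (auto simp: T_def)
    then have "\<bar>real_of_int (e j i)\<bar> \<le> real m" by (auto simp: abs_le_iff)
    then show "\<bar>a i j\<bar> \<le> 1" using m by (simp add: a_def)
  next
    fix i x assume i: "i \<in> J" and x: "x \<in> space L"
    have "restrict (\<lambda>i. \<lfloor>real m * s i x\<rfloor>) J \<in> T" unfolding T_def using range by (simp add: restrict_PiE_iff)
    then obtain k where k: "k < n" "e k = restrict (\<lambda>i. \<lfloor>real m * s i x\<rfloor>) J"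
      using e unfolding bij_betw_def by (metis imageE lessThan_iff)
    have "x \<in> A j \<longleftrightarrow> j = k" if "j < n" for j
    proof
      assume xA: "x \<in> A j"
      have "e j = e k" unfolding k(2) using eT[OF that] xA
        by (intro PiE_ext[of "e j" J "\<lambda>_. UNIV"]) (auto simp: T_def A_def)
      then show "j = k" using e that k(1) by (auto simp: bij_betw_def inj_on_def)
    next
      assume "j = k" then show "x \<in> A j" using k x by (simp add: A_def)
    qed
    then have "(\<Sum>j<n. a i j * indicator (A j) x) = (\<Sum>j<n. if j = k then a i j else 0)"
      by (intro sum.cong) (auto simp: indicator_def)
    also have "\<dots> = real_of_int \<lfloor>real m * s i x\<rfloor> / real m"
      using k i by (simp add: a_def)
    finally have "s i x - (\<Sum>j<n. a i j * indicator (A j) x) = frac (real m * s i x) / real m"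
      using m by (simp add: frac_def field_simps)
    then show "\<bar>s i x - (\<Sum>j<n. a i j * indicator (A j) x)\<bar> \<le> 1 / real m"
      using frac_lt_1[of "real m * s i x"] by (simp add: divide_right_mono less_imp_le)
  qed
qed

text \<open>
  Integrate the uniform estimate \<open>\<epsilon>\<close>. It will be applied to the intensity measure and to the
  realizations of the process alike.
\<close>

lemma integral_close_to_step:
  fixes s :: "'x \<Rightarrow> real"
  assumes "finite_measure \<nu>" and s: "s \<in> borel_measurable \<nu>" and b: "\<And>x. \<bar>s x\<bar> \<le> 1"
    and A: "\<And>j. j < n \<Longrightarrow> A j \<in> sets \<nu>"
    and close: "\<And>x. x \<in> space \<nu> \<Longrightarrow> \<bar>s x - (\<Sum>j<n. a j * indicator (A j) x)\<bar> \<le> \<epsilon>"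
  shows "\<bar>(\<integral>x. s x \<partial>\<nu>) - (\<Sum>j<n. a j * measure \<nu> (A j))\<bar> \<le> \<epsilon> * measure \<nu> (space \<nu>)"
proof -
  interpret finite_measure \<nu> by fact
  have int_s: "integrable \<nu> s" using s b by (intro integrable_const_bound[of _ 1]) auto
  have ia: "integrable \<nu> (\<lambda>x. a j * indicator (A j) x)" if "j < n" for j
    using A[OF that] by (intro integrable_mult_right integrable_real_indicator) (auto simp: emeasure_eq_measure)
  have iS: "integrable \<nu> (\<lambda>x. \<Sum>j<n. a j * indicator (A j) x)"
    using ia by (intro Bochner_Integration.integrable_sum) auto
  have "(\<integral>x. (\<Sum>j<n. a j * indicator (A j) x) \<partial>\<nu>) = (\<Sum>j<n. a j * measure \<nu> (A j))"
    using A ia by (subst Bochner_Integration.integral_sum) (auto intro!: sum.cong)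
  then have "(\<integral>x. s x \<partial>\<nu>) - (\<Sum>j<n. a j * measure \<nu> (A j)) = (\<integral>x. s x - (\<Sum>j<n. a j * indicator (A j) x) \<partial>\<nu>)"
    using int_s iS by simp
  then have "\<bar>(\<integral>x. s x \<partial>\<nu>) - (\<Sum>j<n. a j * measure \<nu> (A j))\<bar>
      = \<bar>\<integral>x. s x - (\<Sum>j<n. a j * indicator (A j) x) \<partial>\<nu>\<bar>" by (rule arg_cong)
  also have "\<dots> \<le> (\<integral>x. \<bar>s x - (\<Sum>j<n. a j * indicator (A j) x)\<bar> \<partial>\<nu>)" by (rule integral_abs_bound)
  also have "\<dots> \<le> (\<integral>x. \<epsilon> \<partial>\<nu>)"
    using int_s iS close by (intro integral_mono) auto
  also have "\<dots> = \<epsilon> * measure \<nu> (space \<nu>)" by simp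
  finally show ?thesis .
qed

section \<open>Passage to the limit\<close>


locale finite_poisson_process = prob_space M for M :: "'w measure" +
  fixes \<Lambda> :: "'a::topological_space measure" and N :: "'w \<Rightarrow> 'a measure"
  assumes sets_\<Lambda>: "sets \<Lambda> = sets borel" and finite_\<Lambda>: "finite_measure \<Lambda>"
    and process: "poisson_point_process M \<Lambda> N"
begin

lemma space_\<Lambda>: "space \<Lambda> = UNIV"
  using sets_eq_imp_space_eq[OF sets_\<Lambda>] by simp

lemmas process_unfolded = process[unfolded poisson_point_process_def]
lemmas process_values = process_unfolded[THEN conjunct1, rule_format]
lemmas process_law = process_unfolded[THEN conjunct2, THEN conjunct2, THEN conjunct1, rule_format]
lemmas process_indep = process_unfolded[THEN conjunct2, THEN conjunct2, THEN conjunct2, rule_format]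

lemma sets_N: "\<omega> \<in> space M \<Longrightarrow> sets (N \<omega>) = sets borel"
  using process_values[of \<omega>] sets_\<Lambda> by simp

lemma space_N: "\<omega> \<in> space M \<Longrightarrow> space (N \<omega>) = UNIV"
  using sets_eq_imp_space_eq[OF sets_N] by simp

lemma N_in_nat: "\<omega> \<in> space M \<Longrightarrow> B \<in> sets borel \<Longrightarrow> \<exists>k. emeasure (N \<omega>) B = of_nat k"
  using process_values[of \<omega>] sets_\<Lambda> by blast

lemma finite_N: "\<omega> \<in> space M \<Longrightarrow> finite_measure (N \<omega>)"
  using N_in_nat[of \<omega> UNIV] by (intro finite_measureI) (auto simp: space_N)

text \<open>
  The point counts as natural numbers, with default value \<open>0\<close> outside the index set, in accordance with
  the default of \<open>poisson_field\<close>.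
\<close>

definition counts :: "nat \<Rightarrow> (nat \<Rightarrow> 'a set) \<Rightarrow> 'w \<Rightarrow> nat \<Rightarrow> nat" where
  "counts n A \<omega> i = (if i < n then nat \<lfloor>measure (N \<omega>) (A i)\<rfloor> else 0)"

lemma real_counts:
  assumes "\<omega> \<in> space M" "i < n" "A i \<in> sets borel"
  shows "real (counts n A \<omega> i) = measure (N \<omega>) (A i)"
proof -
  obtain k where "emeasure (N \<omega>) (A i) = of_nat k" using N_in_nat assms by blast
  then have "measure (N \<omega>) (A i) = real k" by (simp add: measure_def)
  then show ?thesis using assms by (simp add: counts_def)
qed

lemma
  assumes n: "n > 0" and A: "\<And>j. j < n \<Longrightarrow> A j \<in> sets borel" "disjoint_family_on A {..<n}"
  shows measurable_counts: "counts n A \<in> M \<rightarrow>\<^sub>M count_space UNIV"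
    and distr_counts: "distr M (count_space UNIV) (counts n A)
      = measure_pmf (poisson_field (\<lambda>j. measure \<Lambda> (A j)) {..<n})"
proof -
  have "indep_vars (\<lambda>_. borel) (\<lambda>i \<omega>. measure (N \<omega>) (A i)) {..<n}"
    using A sets_\<Lambda> by (intro process_indep) auto
  then have "indep_vars (\<lambda>_. borel) (\<lambda>i \<omega>. real (nat \<lfloor>measure (N \<omega>) (A i)\<rfloor>)) {..<n}"
    by (rule indep_vars_compose2[where Y = "\<lambda>_ y. real (nat \<lfloor>y\<rfloor>)"]) measurable
  then have indep: "indep_vars (\<lambda>_. borel) (\<lambda>i \<omega>. real (counts n A \<omega> i)) {..<n}"
    by (rule indep_vars_cong[THEN iffD1, rotated -1]) (auto simp: counts_def)
  have law: "prob {\<omega>\<in>space M. counts n A \<omega> i = k}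
      = measure \<Lambda> (A i) ^ k / fact k * exp (- measure \<Lambda> (A i))" if i: "i < n" for i k
  proof -
    have "counts n A \<omega> i = k \<longleftrightarrow> measure (N \<omega>) (A i) = real k" if "\<omega> \<in> space M" for \<omega>
      using real_counts[where A = A, OF that i] A(1)[OF i] by (metis of_nat_eq_iff)
    then have "{\<omega>\<in>space M. counts n A \<omega> i = k} = {\<omega>\<in>space M. measure (N \<omega>) (A i) = real k}"
      by blast
    then show ?thesis using process_law[of "A i" k] A(1)[OF i] sets_\<Lambda> by simp
  qed
  show "counts n A \<in> M \<rightarrow>\<^sub>M count_space UNIV"
    "distr M (count_space UNIV) (counts n A)
      = measure_pmf (poisson_field (\<lambda>j. measure \<Lambda> (A j)) {..<n})"
    by (rule distr_independent_poisson[OF n _ indep law]; simp add: counts_def)+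
qed

text \<open>
  The total mass of \<open>N \<omega>\<close> and the intensity together. It is the Lipschitz constant, in the uniform norm,
  of the centred integrals \<open>I\<close> below, and it has exponential moments of every order. All dominating
  functions are built from it.
\<close>

definition K :: "'w \<Rightarrow> real" where
  "K \<omega> = measure (N \<omega>) UNIV + measure \<Lambda> UNIV"

lemma K_nonneg: "K \<omega> \<ge> 0" by (simp add: K_def)

lemma integrable_exp_K: "integrable M (\<lambda>\<omega>. exp (c * K \<omega>))"
proof -
  let ?A = "\<lambda>_::nat. UNIV :: 'a set"
  let ?P = "poisson_field (\<lambda>j. measure \<Lambda> (?A j)) {..<1}"
  have dis: "disjoint_family_on ?A {..<1}" by (auto simp: disjoint_family_on_def)
  have meas: "counts 1 ?A \<in> M \<rightarrow>\<^sub>M count_space UNIV" by (rule measurable_counts) (use dis in auto)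
  have "exp_growth (total_count {..<1}) (\<lambda>x::nat \<Rightarrow> nat. exp (c * real (x 0)))"
    by (rule exp_growth_exp[of _ 1]) (auto simp: total_count_def)
  then have "integrable ?P (\<lambda>x. exp (c * real (x 0)))"
    by (intro integrable_poisson_field) auto
  then have "integrable (distr M (count_space UNIV) (counts 1 ?A)) (\<lambda>x. exp (c * real (x 0)))"
    by (subst distr_counts) (use dis in auto)
  then have "integrable M (\<lambda>\<omega>. exp (c * real (counts 1 ?A \<omega> 0)))"
    by (subst (asm) integrable_distr_eq[OF meas]) auto
  then have "integrable M (\<lambda>\<omega>. exp (c * measure \<Lambda> UNIV) * exp (c * real (counts 1 ?A \<omega> 0)))"
    by (rule integrable_mult_right)
  moreover have "exp (c * measure \<Lambda> UNIV) * exp (c * real (counts 1 ?A \<omega> 0)) = exp (c * K \<omega>)"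
    if "\<omega> \<in> space M" for \<omega>
    using real_counts[OF that, of 0 1 ?A] by (simp add: K_def algebra_simps flip: exp_add)
  ultimately show ?thesis by (subst (asm) Bochner_Integration.integrable_cong[OF refl]) auto
qed

lemma measurable_K [measurable]: "K \<in> borel_measurable M"
proof -
  have "(\<lambda>\<omega>. ln (exp (1 * K \<omega>))) \<in> borel_measurable M"
    using borel_measurable_integrable[OF integrable_exp_K[of 1]] by measurable
  then show ?thesis by simp
qed

lemma integrable_K_bound:
  assumes "f \<in> borel_measurable M" "\<And>\<omega>. \<omega> \<in> space M \<Longrightarrow> \<bar>f \<omega>\<bar> \<le> exp (c * K \<omega>)"
  shows "integrable M f"
  by (rule Bochner_Integration.integrable_bound[OF integrable_exp_K[of c]]) (use assms in auto)

lemma integrable_K: "integrable M K"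
proof (rule integrable_K_bound[of _ 1])
  show "\<bar>K \<omega>\<bar> \<le> exp (1 * K \<omega>)" for \<omega>
    using abs_le_exp_abs[of "K \<omega>"] K_nonneg[of \<omega>] by simp
qed measurable

lemma K2_le_exp: "(K \<omega>)\<^sup>2 \<le> exp (2 * K \<omega>)"
proof -
  have "K \<omega> \<le> exp (K \<omega>)" using exp_ge_add_one_self[of "K \<omega>"] by linarith
  then have "(K \<omega>)\<^sup>2 \<le> (exp (K \<omega>))\<^sup>2" using K_nonneg by (intro power_mono) auto
  then show ?thesis by (simp add: exp_double)
qed

lemma integrable_K2: "integrable M (\<lambda>\<omega>. (K \<omega>)\<^sup>2)"
  by (rule integrable_K_bound[of _ 2]) (use K2_le_exp in auto)

definition I :: "('a \<Rightarrow> real) \<Rightarrow> 'w \<Rightarrow> real" where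
  "I s \<omega> = (\<integral>x. s x \<partial>N \<omega>) - (\<integral>x. s x \<partial>\<Lambda>)"

lemma abs_I_le:
  assumes s: "s \<in> borel_measurable borel" "\<And>x. \<bar>s x\<bar> \<le> 1" and \<omega>: "\<omega> \<in> space M"
  shows "\<bar>I s \<omega>\<bar> \<le> K \<omega>"
proof -
  have *: "\<bar>\<integral>x. s x \<partial>\<nu>\<bar> \<le> measure \<nu> UNIV" if "finite_measure \<nu>" "sets \<nu> = sets borel" for \<nu> :: "'a measure"
    using integral_close_to_step[OF that(1), of s 0 "\<lambda>_. {}" "\<lambda>_. 0" 1] s that(2)
    by (simp add: measurable_cong_sets[OF that(2) refl] sets_eq_imp_space_eq[OF that(2)])
  show ?thesis
    using *[OF finite_N[OF \<omega>] sets_N[OF \<omega>]] *[OF finite_\<Lambda> sets_\<Lambda>] unfolding I_def K_def by linarith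
qed

text \<open>
  For finitely many functions the process may be replaced by the finite-dimensional model, at the price
  of an error of at most \<open>K \<omega> / m\<close>.
\<close>

lemma step_approximation:
  fixes s :: "'i \<Rightarrow> 'a \<Rightarrow> real" and m :: nat
  assumes J: "finite J" "J \<noteq> {}" and m: "m > 0"
    and s: "\<And>i. i \<in> J \<Longrightarrow> s i \<in> borel_measurable borel" "\<And>i x. i \<in> J \<Longrightarrow> \<bar>s i x\<bar> \<le> 1"
  obtains I' :: "'i \<Rightarrow> 'w \<Rightarrow> real" where
    "\<And>i. i \<in> J \<Longrightarrow> I' i \<in> borel_measurable M"
    "\<And>i \<omega>. i \<in> J \<Longrightarrow> \<omega> \<in> space M \<Longrightarrow> \<bar>I' i \<omega> - I (s i) \<omega>\<bar> \<le> K \<omega> / real m"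
    "\<And>i. i \<in> J \<Longrightarrow> expectation (I' i) = 0"
    "(\<lambda>\<omega>. Max ((\<lambda>i. I' i \<omega>) ` J)) \<in> borel_measurable M"
    "\<And>V t. (\<And>i. i \<in> J \<Longrightarrow> expectation (\<lambda>\<omega>. (I' i \<omega>)\<^sup>2) \<le> V) \<Longrightarrow> t \<ge> 0 \<Longrightarrow>
      ln (expectation (\<lambda>\<omega>. exp (- t * Max ((\<lambda>i. I' i \<omega>) ` J))))
      \<le> - t * expectation (\<lambda>\<omega>. Max ((\<lambda>i. I' i \<omega>) ` J))
        + (2 * expectation (\<lambda>\<omega>. Max ((\<lambda>i. I' i \<omega>) ` J)) + V) / 9 * (exp (3 * t) - 3 * t - 1)"
proof -
  obtain n :: nat and A :: "nat \<Rightarrow> 'a set" and a :: "'i \<Rightarrow> nat \<Rightarrow> real"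
    where n: "n > 0" and A: "\<And>j. j < n \<Longrightarrow> A j \<in> sets borel" "disjoint_family_on A {..<n}"
      and a: "\<And>i j. i \<in> J \<Longrightarrow> j < n \<Longrightarrow> \<bar>a i j\<bar> \<le> 1"
      and close: "\<And>i x. i \<in> J \<Longrightarrow> x \<in> space borel \<Longrightarrow> \<bar>s i x - (\<Sum>j<n. a i j * indicator (A j) x)\<bar> \<le> 1 / real m"
    by (rule simultaneous_discretization[where L = "borel :: 'a measure" and s = s, OF J(1) m s]) auto
  interpret W: weighted_poisson_max "\<lambda>j. measure \<Lambda> (A j)" "{..<n}" J a
    by standard (use a J in auto)
  note meas = measurable_counts[OF n A] and distr = distr_counts[OF n A]
  have E: "expectation (\<lambda>\<omega>. g (counts n A \<omega>)) = W.E g" for g :: "(nat \<Rightarrow> nat) \<Rightarrow> real"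
  proof -
    have "W.E g = integral\<^sup>L (distr M (count_space UNIV) (counts n A)) g" by (simp only: distr)
    also have "\<dots> = expectation (\<lambda>\<omega>. g (counts n A \<omega>))" by (rule integral_distr[OF meas]) (auto simp: measurable_count_space_eq1)
    finally show ?thesis ..
  qed
  have meas_comp: "(\<lambda>\<omega>. g (counts n A \<omega>)) \<in> borel_measurable M" for g :: "(nat \<Rightarrow> nat) \<Rightarrow> real"
    using meas by (rule measurable_compose) (auto simp: measurable_count_space_eq1)
  show thesis
  proof (rule that[of "\<lambda>i \<omega>. W.Y i (counts n A \<omega>)"], unfold W.Z_def[symmetric])
    fix i \<omega> assume i: "i \<in> J" and \<omega>: "\<omega> \<in> space M"
    have st: "\<bar>(\<integral>x. s i x \<partial>\<nu>) - (\<Sum>j<n. a i j * measure \<nu> (A j))\<bar> \<le> 1 / real m * measure \<nu> UNIV"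
      if "finite_measure \<nu>" "sets \<nu> = sets borel" for \<nu> :: "'a measure"
      using integral_close_to_step[OF that(1), of "s i" n A "a i" "1 / real m"] s[OF i] A(1) close[OF i] that(2)
      by (simp add: measurable_cong_sets[OF that(2) refl] sets_eq_imp_space_eq[OF that(2)])
    have "W.Y i (counts n A \<omega>) = (\<Sum>j<n. a i j * measure (N \<omega>) (A j)) - (\<Sum>j<n. a i j * measure \<Lambda> (A j))"
      unfolding W.Y_def using \<omega> A(1)
      by (simp add: real_counts right_diff_distrib sum_subtractf)
    moreover have "K \<omega> / real m = 1 / real m * measure (N \<omega>) UNIV + 1 / real m * measure \<Lambda> UNIV"
      by (simp add: K_def add_divide_distrib)
    ultimately show "\<bar>W.Y i (counts n A \<omega>) - I (s i) \<omega>\<bar> \<le> K \<omega> / real m"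
      using st[OF finite_N[OF \<omega>] sets_N[OF \<omega>]] st[OF finite_\<Lambda> sets_\<Lambda>] unfolding I_def by linarith
  next
    fix i assume "i \<in> J"
    then show "expectation (\<lambda>\<omega>. W.Y i (counts n A \<omega>)) = 0" unfolding E by (rule W.expectation_Y)
  next
    fix V t :: real
    assume "\<And>i. i \<in> J \<Longrightarrow> expectation (\<lambda>\<omega>. (W.Y i (counts n A \<omega>))\<^sup>2) \<le> V" "t \<ge> 0"
    then show "ln (expectation (\<lambda>\<omega>. exp (- t * W.Z (counts n A \<omega>))))
      \<le> - t * expectation (\<lambda>\<omega>. W.Z (counts n A \<omega>))
        + (2 * expectation (\<lambda>\<omega>. W.Z (counts n A \<omega>)) + V) / 9 * (exp (3 * t) - 3 * t - 1)"
      using W.log_laplace_bound[of t V] E[of "\<lambda>x. (W.Y i x)\<^sup>2" for i] E[of "\<lambda>x. exp (- t * W.Z x)"] E[of W.Z]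
      by simp
  qed (rule meas_comp)+
qed

end

lemma div_Suc_tendsto_0: "(\<lambda>m. c / real (Suc m)) \<longlonglongrightarrow> 0"
  using tendsto_mult_right_zero[OF LIMSEQ_inverse_real_of_nat, of c] by (simp add: divide_inverse)

context finite_poisson_process
begin

text \<open>
  Measurability and centring of \<open>I s\<close> are inherited from its step approximations.
\<close>

lemma
  assumes s: "s \<in> borel_measurable borel" "\<And>x. \<bar>s x\<bar> \<le> 1"
  shows measurable_I: "I s \<in> borel_measurable M"
    and integrable_I: "integrable M (I s)"
    and expectation_I: "expectation (I s) = 0"
    and integrable_I2: "integrable M (\<lambda>\<omega>. (I s \<omega>)\<^sup>2)"
    and expectation_I2_le: "expectation (\<lambda>\<omega>. (I s \<omega>)\<^sup>2) \<le> expectation (\<lambda>\<omega>. (K \<omega>)\<^sup>2)"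
proof -
  have "\<exists>I'. I' \<in> borel_measurable M \<and> (\<forall>\<omega>\<in>space M. \<bar>I' \<omega> - I s \<omega>\<bar> \<le> K \<omega> / real (Suc m)) \<and> expectation I' = 0" for m
    by (rule step_approximation[of "{()}" "Suc m" "\<lambda>_. s"]) (use s in auto)
  then obtain I' where I': "\<And>m. I' m \<in> borel_measurable M"
      "\<And>m \<omega>. \<omega> \<in> space M \<Longrightarrow> \<bar>I' m \<omega> - I s \<omega>\<bar> \<le> K \<omega> / real (Suc m)"
      "\<And>m. expectation (I' m) = 0"
    by metis
  have lim: "(\<lambda>m. I' m \<omega>) \<longlonglongrightarrow> I s \<omega>" if "\<omega> \<in> space M" for \<omega>
  proof (rule LIM_zero_cancel, rule Lim_null_comparison)
    show "\<forall>\<^sub>F m in sequentially. norm (I' m \<omega> - I s \<omega>) \<le> K \<omega> / real (Suc m)"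
      using I'(2)[OF that] by simp
    show "(\<lambda>m. K \<omega> / real (Suc m)) \<longlonglongrightarrow> 0" by (rule div_Suc_tendsto_0)
  qed
  show meas: "I s \<in> borel_measurable M"
    by (rule borel_measurable_LIMSEQ_real[OF lim I'(1)])
  show int: "integrable M (I s)"
    by (rule Bochner_Integration.integrable_bound[OF integrable_K meas])
       (use abs_I_le[OF s] K_nonneg in auto)
  show int2: "integrable M (\<lambda>\<omega>. (I s \<omega>)\<^sup>2)"
  proof (rule Bochner_Integration.integrable_bound[OF integrable_K2])
    show "AE \<omega> in M. norm ((I s \<omega>)\<^sup>2) \<le> norm ((K \<omega>)\<^sup>2)"
      using abs_I_le[OF s] K_nonneg by (auto simp: abs_le_square_iff[symmetric])
  qed (use meas in measurable)
  show "expectation (\<lambda>\<omega>. (I s \<omega>)\<^sup>2) \<le> expectation (\<lambda>\<omega>. (K \<omega>)\<^sup>2)"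
    using abs_I_le[OF s] K_nonneg
    by (intro integral_mono int2 integrable_K2) (auto simp: abs_le_square_iff[symmetric])
  have "(\<lambda>m. expectation (I' m)) \<longlonglongrightarrow> expectation (I s)"
  proof (rule integral_dominated_convergence[where w = "\<lambda>\<omega>. 2 * K \<omega>"])
    show "AE \<omega> in M. (\<lambda>m. I' m \<omega>) \<longlonglongrightarrow> I s \<omega>" using lim by auto
    show "AE \<omega> in M. norm (I' m \<omega>) \<le> 2 * K \<omega>" for m
    proof (rule AE_I2)
      fix \<omega> assume \<omega>: "\<omega> \<in> space M"
      have "K \<omega> / real (Suc m) \<le> K \<omega> / 1" using K_nonneg by (intro divide_left_mono) auto
      then show "norm (I' m \<omega>) \<le> 2 * K \<omega>" using I'(2)[OF \<omega>, of m] abs_I_le[OF s \<omega>] by simp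
    qed
  qed (use I'(1) meas integrable_K in auto)
  then show "expectation (I s) = 0" using I'(3) by (simp add: LIMSEQ_const_iff)
qed

end

locale poisson_supremum = finite_poisson_process M \<Lambda> N
  for M :: "'w measure" and \<Lambda> :: "'a::topological_space measure" and N :: "'w \<Rightarrow> 'a measure" +
  fixes S :: "('a \<Rightarrow> real) set"
  assumes S: "countable S" "S \<noteq> {}"
    and s: "\<And>s. s \<in> S \<Longrightarrow> s \<in> borel_measurable borel" "\<And>s x. s \<in> S \<Longrightarrow> \<bar>s x\<bar> \<le> 1"
begin

definition Z :: "'w \<Rightarrow> real" where "Z \<omega> = (SUP s\<in>S. I s \<omega>)"

definition V :: real where "V = (SUP s\<in>S. variance (I s))"

lemma I_le_K: "\<omega> \<in> space M \<Longrightarrow> s \<in> S \<Longrightarrow> I s \<omega> \<le> K \<omega>"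
  using abs_I_le[OF s] by (meson abs_le_D1)

lemma bdd_above_I: "\<omega> \<in> space M \<Longrightarrow> bdd_above ((\<lambda>s. I s \<omega>) ` S)"
  using I_le_K by (intro bdd_aboveI[of _ "K \<omega>"]) auto

lemma I_le_Z: "\<omega> \<in> space M \<Longrightarrow> s \<in> S \<Longrightarrow> I s \<omega> \<le> Z \<omega>"
  unfolding Z_def by (intro cSUP_upper bdd_above_I)

lemma abs_Z_le_K:
  assumes \<omega>: "\<omega> \<in> space M" shows "\<bar>Z \<omega>\<bar> \<le> K \<omega>"
proof -
  obtain s0 where s0: "s0 \<in> S" using S by auto
  have "- K \<omega> \<le> Z \<omega>" using I_le_Z[OF \<omega> s0] abs_I_le[OF s[OF s0] \<omega>] by linarith
  moreover have "Z \<omega> \<le> K \<omega>"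
    unfolding Z_def using S I_le_K[OF \<omega>] by (intro cSUP_least)
  ultimately show ?thesis by linarith
qed

lemma variance_I_le_V: "s \<in> S \<Longrightarrow> expectation (\<lambda>\<omega>. (I s \<omega>)\<^sup>2) \<le> V"
proof -
  assume sS: "s \<in> S"
  have eq: "variance (I s) = expectation (\<lambda>\<omega>. (I s \<omega>)\<^sup>2)" if "s \<in> S" for s
    using expectation_I[OF s[OF that]] by simp
  have "variance (I s) \<le> V" unfolding V_def
    using sS by (rule cSUP_upper)
      (intro bdd_aboveI[of _ "expectation (\<lambda>\<omega>. (K \<omega>)\<^sup>2)"], use eq expectation_I2_le s in fastforce)
  then show ?thesis by (simp only: eq[OF sS])
qed

lemma V_nonneg: "V \<ge> 0"
proof -
  obtain s0 where s0: "s0 \<in> S" using S by auto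
  have "0 \<le> expectation (\<lambda>\<omega>. (I s0 \<omega>)\<^sup>2)" by simp
  then show ?thesis using variance_I_le_V[OF s0] by linarith
qed

text \<open>
  The supremum over \<open>S\<close> is the pointwise limit of maxima over the first \<open>m + 1\<close> members of an
  enumeration, each discretized with accuracy \<open>1 / (m + 1)\<close>. Second moments increase by at most
  \<open>3 * E K\<^sup>2 / (m + 1)\<close>, and everything else converges by dominated convergence with majorants in \<open>K\<close>.
\<close>

lemma
  shows measurable_Z: "Z \<in> borel_measurable M"
    and log_laplace_sup: "t \<ge> 0 \<Longrightarrow> ln (expectation (\<lambda>\<omega>. exp (- t * Z \<omega>)))
      \<le> - t * expectation Z + (2 * expectation Z + V) / 9 * (exp (3 * t) - 3 * t - 1)"
proof -
  define f where "f = from_nat_into S"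
  have fS: "f i \<in> S" for i unfolding f_def using S by (intro from_nat_into)
  have f_surj: "\<exists>i. s = f i" if "s \<in> S" for s
    using range_from_nat_into[OF S(2,1)] that unfolding f_def by auto
  note sf = s[OF fS]
  let ?K2 = "expectation (\<lambda>\<omega>. (K \<omega>)\<^sup>2)"
  let ?Z = "\<lambda>I' m \<omega>. Max ((\<lambda>i. I' i \<omega>) ` {..m::nat})"
  \<comment> \<open>the approximation of stage \<open>m\<close>, as one predicate for the sake of choosing a sequence\<close>
  define P where "P = (\<lambda>m I'. (\<forall>i\<le>m. I' i \<in> borel_measurable M)
      \<and> (\<forall>i\<le>m. \<forall>\<omega>\<in>space M. \<bar>I' i \<omega> - I (f i) \<omega>\<bar> \<le> K \<omega> / real (Suc m))
      \<and> ?Z I' m \<in> borel_measurable M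
      \<and> (\<forall>V t. (\<forall>i\<le>m. expectation (\<lambda>\<omega>. (I' i \<omega>)\<^sup>2) \<le> V) \<longrightarrow> t \<ge> 0 \<longrightarrow>
          ln (expectation (\<lambda>\<omega>. exp (- t * ?Z I' m \<omega>)))
          \<le> - t * expectation (?Z I' m) + (2 * expectation (?Z I' m) + V) / 9 * (exp (3 * t) - 3 * t - 1)))"
  have "\<exists>I'. P m I'" for m
  proof (rule step_approximation[of "{..m}" "Suc m" f], goal_cases)
    case (6 I')
    show ?case unfolding P_def
    proof (intro exI[of _ I'] conjI allI impI ballI)
      show "?Z I' m \<in> borel_measurable M" by (rule 6)
      show "ln (expectation (\<lambda>\<omega>. exp (- t * ?Z I' m \<omega>)))
          \<le> - t * expectation (?Z I' m) + (2 * expectation (?Z I' m) + V) / 9 * (exp (3 * t) - 3 * t - 1)"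
        if "\<forall>i\<le>m. expectation (\<lambda>\<omega>. (I' i \<omega>)\<^sup>2) \<le> V" "t \<ge> 0" for V t
        by (rule 6(5)) (use that in auto)
    qed (use 6(1,2) in auto)
  qed (use sf in auto)
  then obtain I' where "\<And>m. P m (I' m)" by metis
  then have I':
      "\<And>m i. i \<le> m \<Longrightarrow> I' m i \<in> borel_measurable M"
      "\<And>m i \<omega>. i \<le> m \<Longrightarrow> \<omega> \<in> space M \<Longrightarrow> \<bar>I' m i \<omega> - I (f i) \<omega>\<bar> \<le> K \<omega> / real (Suc m)"
      "\<And>m. ?Z (I' m) m \<in> borel_measurable M"
      "\<And>m V t. (\<And>i. i \<le> m \<Longrightarrow> expectation (\<lambda>\<omega>. (I' m i \<omega>)\<^sup>2) \<le> V) \<Longrightarrow> t \<ge> 0 \<Longrightarrow>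
          ln (expectation (\<lambda>\<omega>. exp (- t * ?Z (I' m) m \<omega>)))
          \<le> - t * expectation (?Z (I' m) m) + (2 * expectation (?Z (I' m) m) + V) / 9 * (exp (3 * t) - 3 * t - 1)"
    unfolding P_def by blast+
  define Zm where "Zm = (\<lambda>m. ?Z (I' m) m)"
  have Zm_meas: "Zm m \<in> borel_measurable M" for m unfolding Zm_def by (rule I')
  have KSuc: "K \<omega> / real (Suc m) \<le> K \<omega>" for \<omega> m
  proof -
    have "K \<omega> / real (Suc m) \<le> K \<omega> / 1" using K_nonneg by (intro divide_left_mono) auto
    then show ?thesis by simp
  qed
  have Zm_ge: "I' m i \<omega> \<le> Zm m \<omega>" if "i \<le> m" for m i \<omega>
    unfolding Zm_def using that by (intro Max_ge) auto
  have Zm_attained: "\<exists>i\<le>m. Zm m \<omega> = I' m i \<omega>" for m \<omega>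
  proof -
    have "Zm m \<omega> \<in> (\<lambda>i. I' m i \<omega>) ` {..m}" unfolding Zm_def by (intro Max_in) auto
    then show ?thesis by auto
  qed
  have bound: "\<bar>I' m i \<omega>\<bar> \<le> 2 * K \<omega>" if "i \<le> m" "\<omega> \<in> space M" for m i \<omega>
    using I'(2)[OF that] abs_I_le[OF sf that(2), of i] KSuc[of \<omega> m] by linarith
  have Zm_bound: "\<bar>Zm m \<omega>\<bar> \<le> 2 * K \<omega>" if "\<omega> \<in> space M" for m \<omega>
    using Zm_attained[of m \<omega>] bound that by metis
  have lim: "(\<lambda>m. Zm m \<omega>) \<longlonglongrightarrow> Z \<omega>" if \<omega>: "\<omega> \<in> space M" for \<omega>
  proof (rule tendstoI)
    fix e :: real assume e: "e > 0"
    obtain s0 where s0: "s0 \<in> S" "Z \<omega> - e / 2 < I s0 \<omega>"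
      using less_cSUP_iff[OF S(2) bdd_above_I[OF \<omega>], of "Z \<omega> - e / 2"] e by (auto simp: Z_def)
    then obtain i0 where i0: "s0 = f i0" using f_surj by auto
    have "\<forall>\<^sub>F m in sequentially. K \<omega> / real (Suc m) < e / 2"
      using order_tendstoD(2)[OF div_Suc_tendsto_0] e by simp
    then show "\<forall>\<^sub>F m in sequentially. dist (Zm m \<omega>) (Z \<omega>) < e"
      using eventually_ge_at_top[of i0]
    proof eventually_elim
      case (elim m)
      have "Z \<omega> - e < Zm m \<omega>"
        using Zm_ge[OF elim(2), of \<omega>] I'(2)[OF elim(2) \<omega>] s0(2) elim(1) unfolding i0 by linarith
      moreover obtain i where i: "i \<le> m" "Zm m \<omega> = I' m i \<omega>" using Zm_attained[of m \<omega>] by auto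
      have "Zm m \<omega> < Z \<omega> + e"
        using I'(2)[OF i(1) \<omega>] I_le_Z[OF \<omega> fS[of i]] elim(1) e unfolding i(2) by linarith
      ultimately show ?case by (simp add: dist_real_def abs_less_iff)
    qed
  qed
  show meas: "Z \<in> borel_measurable M"
    by (rule borel_measurable_LIMSEQ_real[OF lim Zm_meas])
  assume t: "t \<ge> 0"
  have "(\<lambda>m. expectation (Zm m)) \<longlonglongrightarrow> expectation Z"
    by (rule integral_dominated_convergence[where w = "\<lambda>\<omega>. 2 * K \<omega>"])
       (use meas Zm_meas integrable_K lim Zm_bound in auto)
  then have rhs: "(\<lambda>m. - t * expectation (Zm m) + (2 * expectation (Zm m) + (V + 3 * ?K2 / real (Suc m))) / 9 * (exp (3 * t) - 3 * t - 1))
      \<longlonglongrightarrow> - t * expectation Z + (2 * expectation Z + (V + 0)) / 9 * (exp (3 * t) - 3 * t - 1)"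
  proof (intro tendsto_intros)
    show "(\<lambda>m. 3 * ?K2 / real (Suc m)) \<longlonglongrightarrow> 0" by (rule div_Suc_tendsto_0)
  qed simp_all
  have "(\<lambda>m. expectation (\<lambda>\<omega>. exp (- t * Zm m \<omega>))) \<longlonglongrightarrow> expectation (\<lambda>\<omega>. exp (- t * Z \<omega>))"
  proof (rule integral_dominated_convergence[where w = "\<lambda>\<omega>. exp (2 * t * K \<omega>)"])
    show "AE \<omega> in M. (\<lambda>m. exp (- t * Zm m \<omega>)) \<longlonglongrightarrow> exp (- t * Z \<omega>)"
      using lim by (intro AE_I2 tendsto_intros)
    show "AE \<omega> in M. norm (exp (- t * Zm m \<omega>)) \<le> exp (2 * t * K \<omega>)" for m
    proof (rule AE_I2)
      fix \<omega> assume "\<omega> \<in> space M"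
      then have "t * (- Zm m \<omega>) \<le> t * (2 * K \<omega>)"
        using Zm_bound[of \<omega> m] t by (intro mult_left_mono) (auto simp: abs_le_iff)
      then show "norm (exp (- t * Zm m \<omega>)) \<le> exp (2 * t * K \<omega>)" by simp
    qed
  qed (use meas Zm_meas integrable_exp_K in measurable)
  moreover have "expectation (\<lambda>\<omega>. exp (- t * Z \<omega>)) > 0"
  proof -
    have "integrable M (\<lambda>\<omega>. exp (- t * Z \<omega>))"
    proof (rule integrable_K_bound[of _ t])
      fix \<omega> assume "\<omega> \<in> space M"
      then have "t * (- Z \<omega>) \<le> t * K \<omega>"
        using abs_Z_le_K[of \<omega>] t by (intro mult_left_mono) (auto simp: abs_le_iff)
      then show "\<bar>exp (- t * Z \<omega>)\<bar> \<le> exp (t * K \<omega>)" by simp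
    qed (use meas in measurable)
    then show ?thesis by (intro expectation_greater) auto
  qed
  ultimately have lhs: "(\<lambda>m. ln (expectation (\<lambda>\<omega>. exp (- t * Zm m \<omega>)))) \<longlonglongrightarrow> ln (expectation (\<lambda>\<omega>. exp (- t * Z \<omega>)))"
    by (intro tendsto_ln) auto
  have second_moment: "expectation (\<lambda>\<omega>. (I' m i \<omega>)\<^sup>2) \<le> V + 3 * ?K2 / real (Suc m)" if i: "i \<le> m" for m i
  proof -
    define \<delta> where "\<delta> = 1 / real (Suc m)"
    have \<delta>: "0 \<le> \<delta>" "\<delta> \<le> 1" by (auto simp: \<delta>_def)
    have pw: "(I' m i \<omega>)\<^sup>2 \<le> (I (f i) \<omega>)\<^sup>2 + 3 * \<delta> * (K \<omega>)\<^sup>2" if \<omega>: "\<omega> \<in> space M" for \<omega>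
    proof -
      have I_K: "\<bar>I (f i) \<omega>\<bar> \<le> K \<omega>" by (rule abs_I_le[OF sf \<omega>])
      have "\<bar>I' m i \<omega>\<bar> \<le> \<bar>I (f i) \<omega>\<bar> + \<delta> * K \<omega>"
        using I'(2)[OF i \<omega>] by (simp add: \<delta>_def)
      then have "\<bar>I' m i \<omega>\<bar>\<^sup>2 \<le> (\<bar>I (f i) \<omega>\<bar> + \<delta> * K \<omega>)\<^sup>2" by (intro power_mono) auto
      also have "\<dots> = (I (f i) \<omega>)\<^sup>2 + 2 * \<delta> * (\<bar>I (f i) \<omega>\<bar> * K \<omega>) + \<delta> * \<delta> * (K \<omega>)\<^sup>2"
        unfolding power2_sum power2_abs power_mult_distrib by (simp add: power2_eq_square mult_ac)
      also have "\<dots> \<le> (I (f i) \<omega>)\<^sup>2 + 2 * \<delta> * (K \<omega> * K \<omega>) + \<delta> * 1 * (K \<omega>)\<^sup>2"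
        using I_K K_nonneg[of \<omega>] \<delta> by (intro add_mono mult_mono) auto
      finally show ?thesis by (simp add: power2_eq_square algebra_simps)
    qed
    have i1: "integrable M (\<lambda>\<omega>. (I (f i) \<omega>)\<^sup>2 + 3 * \<delta> * (K \<omega>)\<^sup>2)"
      by (intro Bochner_Integration.integrable_add integrable_mult_right integrable_I2[OF sf] integrable_K2)
    have "integrable M (\<lambda>\<omega>. (I' m i \<omega>)\<^sup>2)"
    proof (rule Bochner_Integration.integrable_bound[OF i1])
      show "AE \<omega> in M. norm ((I' m i \<omega>)\<^sup>2) \<le> norm ((I (f i) \<omega>)\<^sup>2 + 3 * \<delta> * (K \<omega>)\<^sup>2)"
        using pw \<delta> by (intro AE_I2) (simp add: abs_of_nonneg)
    qed (use I'(1)[OF i] in measurable)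
    then have "expectation (\<lambda>\<omega>. (I' m i \<omega>)\<^sup>2) \<le> expectation (\<lambda>\<omega>. (I (f i) \<omega>)\<^sup>2 + 3 * \<delta> * (K \<omega>)\<^sup>2)"
      using i1 pw by (intro integral_mono) auto
    also have "\<dots> = expectation (\<lambda>\<omega>. (I (f i) \<omega>)\<^sup>2) + 3 * \<delta> * ?K2"
      using integrable_I2[OF sf, of i] integrable_K2 by simp
    also have "\<dots> \<le> V + 3 * \<delta> * ?K2" using variance_I_le_V[OF fS[of i]] by simp
    finally show ?thesis by (simp add: \<delta>_def)
  qed
  have "ln (expectation (\<lambda>\<omega>. exp (- t * Z \<omega>)))
      \<le> - t * expectation Z + (2 * expectation Z + (V + 0)) / 9 * (exp (3 * t) - 3 * t - 1)"
    by (rule LIMSEQ_le[OF lhs rhs])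
       (use I'(4)[OF second_moment t] in \<open>auto simp: Zm_def\<close>)
  then show "ln (expectation (\<lambda>\<omega>. exp (- t * Z \<omega>)))
      \<le> - t * expectation Z + (2 * expectation Z + V) / 9 * (exp (3 * t) - 3 * t - 1)" by simp
qed

lemma integrable_exp_Z: "t \<ge> 0 \<Longrightarrow> integrable M (\<lambda>\<omega>. exp (- t * Z \<omega>))"
proof (rule integrable_K_bound[of _ t])
  fix \<omega> assume "\<omega> \<in> space M" and t: "t \<ge> 0"
  then have "t * (- Z \<omega>) \<le> t * K \<omega>"
    using abs_Z_le_K[of \<omega>] by (intro mult_left_mono) (auto simp: abs_le_iff)
  then show "\<bar>exp (- t * Z \<omega>)\<bar> \<le> exp (t * K \<omega>)" by simp
qed (use measurable_Z in measurable)

lemma expectation_Z_nonneg: "expectation Z \<ge> 0"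
proof -
  obtain s0 where s0: "s0 \<in> S" using S by auto
  have "integrable M Z"
    by (rule Bochner_Integration.integrable_bound[OF integrable_K measurable_Z])
       (use abs_Z_le_K K_nonneg in auto)
  then have "expectation (I s0) \<le> expectation Z"
    using I_le_Z s0 integrable_I[OF s[OF s0]] by (intro integral_mono)
  then show ?thesis by (simp add: expectation_I[OF s[OF s0]])
qed

lemma left_tail_exponential:
  assumes t: "t \<ge> 0"
  shows "prob {\<omega>\<in>space M. Z \<omega> \<le> expectation Z - x}
    \<le> exp ((2 * expectation Z + V) / 9 * (exp (3 * t) - 3 * t - 1) - t * x)"
proof -
  let ?F = "expectation (\<lambda>\<omega>. exp (- t * Z \<omega>))" and ?c = "exp (- t * (expectation Z - x))"
  note [measurable] = measurable_Z
  have F: "?F > 0" using integrable_exp_Z[OF t] by (intro expectation_greater) auto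
  have "prob {\<omega>\<in>space M. Z \<omega> \<le> expectation Z - x} \<le> prob {\<omega>\<in>space M. ?c \<le> exp (- t * Z \<omega>)}"
    using t by (intro finite_measure_mono) (auto simp: mult_left_mono)
  also have "\<dots> \<le> ?F / ?c"
    by (rule integral_Markov_inequality_measure[where A = "space M"]) (use integrable_exp_Z[OF t] in auto)
  also have "?F \<le> exp (- t * expectation Z + (2 * expectation Z + V) / 9 * (exp (3 * t) - 3 * t - 1))"
    using log_laplace_sup[OF t] F by (metis exp_le_cancel_iff exp_ln)
  finally show ?thesis by (simp add: divide_right_mono algebra_simps flip: exp_diff)
qed

end

theorem theorem2p6:
  fixes M :: "'w measure"
    and \<Lambda> :: "'a::polish_space measure"
    and N :: "'w \<Rightarrow> 'a measure"
    and S :: "('a \<Rightarrow> real) set"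
    and I :: "('a \<Rightarrow> real) \<Rightarrow> 'w \<Rightarrow> real"
    and Z :: "'w \<Rightarrow> real"
    and L\<^sub>Z h :: "real \<Rightarrow> real"
    and EZ V \<upsilon> :: real
  assumes "prob_space M"
    and "sets \<Lambda> = sets borel"
    and "finite_measure \<Lambda>"
    and "poisson_point_process M \<Lambda> N"
    and "countable S" and "S \<noteq> {}"
    and "\<And>s. s \<in> S \<Longrightarrow> s \<in> borel_measurable borel"
    and "\<And>s x. s \<in> S \<Longrightarrow> s x \<in> {-1..1}"
    and "I = (\<lambda>s \<omega>. (\<integral>x. s x \<partial>N \<omega>) - (\<integral>x. s x \<partial>\<Lambda>))"
    and "Z = (\<lambda>\<omega>. SUP s\<in>S. I s \<omega>)"
    and "EZ = prob_space.expectation M Z"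
    and "L\<^sub>Z = (\<lambda>t. ln (prob_space.expectation M (\<lambda>\<omega>. exp (t * Z \<omega>))))"
    and "V = (SUP s\<in>S. prob_space.variance M (I s))"
    and "\<upsilon> = 2 * EZ + V"
    and "h = (\<lambda>x. (1 + x) * ln (1 + x) - x)"
  shows
    "(\<forall>t\<ge>0. L\<^sub>Z (- t) \<le> - t * EZ + \<upsilon> / 9 * (exp (3 * t) - 3 * t - 1)) \<and>
     (\<forall>x\<ge>0. measure M {\<omega>\<in>space M. Z \<omega> \<le> EZ - x} \<le> exp (- (\<upsilon> / 9) * h (3 * x / \<upsilon>))) \<and>
     (\<forall>x\<ge>0. measure M {\<omega>\<in>space M. Z \<omega> \<le> EZ - x}
               \<le> exp (- (x\<^sup>2 / (\<upsilon> + sqrt (\<upsilon>\<^sup>2 + 2 * \<upsilon> * x) + x))) \<and>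
             exp (- (x\<^sup>2 / (\<upsilon> + sqrt (\<upsilon>\<^sup>2 + 2 * \<upsilon> * x) + x)))
               \<le> exp (- (x\<^sup>2 / (2 * \<upsilon> + 2 * x))))"
proof -
  interpret prob_space M by fact
  have s: "\<bar>s x\<bar> \<le> 1" if "s \<in> S" for s x
    using assms(8)[OF that, of x] by (auto simp: abs_le_iff)
  interpret P: poisson_supremum M \<Lambda> N S
    by (intro poisson_supremum.intro finite_poisson_process.intro finite_poisson_process_axioms.intro
        poisson_supremum_axioms.intro) (fact assms s)+
  have I: "I = P.I" unfolding assms(9) by (simp add: P.I_def fun_eq_iff)
  have Z: "Z = P.Z" unfolding assms(10) I by (simp add: P.Z_def fun_eq_iff)
  have V: "V = P.V" unfolding assms(13) I by (simp add: P.V_def)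
  have \<upsilon>: "\<upsilon> = 2 * expectation P.Z + P.V" unfolding assms(14,11) Z V ..
  have \<upsilon>0: "\<upsilon> \<ge> 0" unfolding \<upsilon> using P.expectation_Z_nonneg P.V_nonneg by simp
  have tail: "measure M {\<omega>\<in>space M. Z \<omega> \<le> EZ - x} \<le> exp (\<upsilon> / 9 * (exp (3 * t) - 3 * t - 1) - t * x)"
    if "t \<ge> 0" for t x
    unfolding assms(11) Z \<upsilon> by (rule P.left_tail_exponential[OF that])
  show ?thesis
  proof (intro conjI allI impI)
    fix t :: real assume "t \<ge> 0"
    then show "L\<^sub>Z (- t) \<le> - t * EZ + \<upsilon> / 9 * (exp (3 * t) - 3 * t - 1)"
      unfolding assms(12,11) Z \<upsilon> by (rule P.log_laplace_sup)
  next
    fix x :: real assume x: "x \<ge> 0"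
    note bounds = chernoff_bounds[OF \<upsilon>0 x tail assms(15)]
    show "measure M {\<omega>\<in>space M. Z \<omega> \<le> EZ - x} \<le> exp (- (\<upsilon> / 9) * h (3 * x / \<upsilon>))"
      "measure M {\<omega>\<in>space M. Z \<omega> \<le> EZ - x} \<le> exp (- (x\<^sup>2 / (\<upsilon> + sqrt (\<upsilon>\<^sup>2 + 2 * \<upsilon> * x) + x)))"
      "exp (- (x\<^sup>2 / (\<upsilon> + sqrt (\<upsilon>\<^sup>2 + 2 * \<upsilon> * x) + x))) \<le> exp (- (x\<^sup>2 / (2 * \<upsilon> + 2 * x)))"
      by (rule bounds; assumption)+
  qed
qed

end
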